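(* The following statements are equivalent for a graph $G$. (1) $G$ is a $3K_1$-free unit Helly circular-arc graph. (2) $G$ is $\{3K_1,\ W_4,\ W_5,\ \overline{C_6}\}$-free. (3) $\overline G$ is (isomorphic to) an induced subgraph of $\mathbb C_3$. (4) $G$ admits a unit circular-arc model consisting of closed arcs in the circumference of length $3$ with no common end points (i.e. distinct arcs do not share an end point).
   Context: Graphs are simple, undirected, with non-empty countable (possibly infinite) vertex set. $\overline G$ is the complement of $G$; $3K_1$ is the edgeless graph on three vertices; $C_n$ is the $n$-cycle; $W_n$ is the wheel obtained from $C_n$ by adding a universal vertex. For a set $\mathcal F$ of graphs, $G$ is $\mathcal F$-free if no $F\in\mathcal F$ is isomorphic to an induced subgraph of $G$. A circular-arc model of $G$ is a pair $(C,\mathcal A)$ where $C$ is a circle and $\mathcal A$ is a set of circular-arcs of $C$ such that $G$ is isomorphic to the intersection graph of $\mathcal A$. The model is unit if every arc in $\mathcal A$ has unit length, and Helly if whenever the arcs of a subset $\mathcal A'\subseteq\mathcal A$ pairwise intersect, the intersection of all arcs in $\mathcal A'$ is non-empty. $G$ is a unit Helly circular-arc graph if it admits a circular-arc model which is both unit and Helly. The graph $\mathbb C_3$ (generic circular triangle-free graph): its vertex set is a countable dense subset of the unit circle $S^1\subseteq\mathbb R^2$ such that any two distinct points of it lie at a rational angle (in radians, hence never at angle exactly $2\pi/3$), and $xy$ is an edge if and only if both circular arcs with end-points $x$ and $y$ have length strictly larger than $1/3$ of the circumference. Any such choice of vertex set gives the same graph up to isomorphism. *)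

theory Defs
  imports "HOL-Analysis.Analysis"
begin

section \<open>Graphs\<close>

record 'a graph =
  verts :: "'a set"
  adj :: "'a \<Rightarrow> 'a \<Rightarrow> bool"

definition countable_simple_graph :: "'a graph \<Rightarrow> bool" where
  "countable_simple_graph G \<longleftrightarrow>
     verts G \<noteq> {} \<and> countable (verts G) \<and>
     (\<forall>x y. adj G x y \<longrightarrow> x \<in> verts G \<and> y \<in> verts G) \<and>
     (\<forall>x y. adj G x y \<longrightarrow> adj G y x) \<and>
     (\<forall>x. \<not> adj G x x)"

definition graph_complement :: "'a graph \<Rightarrow> 'a graph" where
  "graph_complement G =
     \<lparr>verts = verts G,
      adj = (\<lambda>x y. x \<in> verts G \<and> y \<in> verts G \<and> x \<noteq> y \<and> \<not> adj G x y)\<rparr>"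

definition induced_subgraph :: "'a graph \<Rightarrow> 'a set \<Rightarrow> 'a graph" where
  "induced_subgraph G W =
     \<lparr>verts = W, adj = (\<lambda>x y. x \<in> W \<and> y \<in> W \<and> adj G x y)\<rparr>"

definition graph_isomorphic :: "'a graph \<Rightarrow> 'b graph \<Rightarrow> bool" where
  "graph_isomorphic G H \<longleftrightarrow>
     (\<exists>f. bij_betw f (verts G) (verts H) \<and>
          (\<forall>x\<in>verts G. \<forall>y\<in>verts G. adj G x y \<longleftrightarrow> adj H (f x) (f y)))"

definition isomorphic_to_induced_subgraph :: "'a graph \<Rightarrow> 'b graph \<Rightarrow> bool" where
  "isomorphic_to_induced_subgraph F G \<longleftrightarrow>
     (\<exists>W\<subseteq>verts G. graph_isomorphic F (induced_subgraph G W))"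

definition graph_free :: "'b graph set \<Rightarrow> 'a graph \<Rightarrow> bool" where
  "graph_free \<F> G \<longleftrightarrow> (\<forall>F\<in>\<F>. \<not> isomorphic_to_induced_subgraph F G)"

definition edgeless_graph :: "nat \<Rightarrow> nat graph" where
  "edgeless_graph n = \<lparr>verts = {..<n}, adj = (\<lambda>i j. False)\<rparr>"

definition cycle_graph :: "nat \<Rightarrow> nat graph" where
  "cycle_graph n =
     \<lparr>verts = {..<n},
      adj = (\<lambda>i j. i < n \<and> j < n \<and> (j = (i + 1) mod n \<or> i = (j + 1) mod n))\<rparr>"

definition wheel_graph :: "nat \<Rightarrow> nat graph" where
  "wheel_graph n =
     \<lparr>verts = {..n},
      adj = (\<lambda>i j. adj (cycle_graph n) i j \<or> (i = n \<and> j < n) \<or> (i < n \<and> j = n))\<rparr>"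


section \<open>Circular-arc models\<close>

text \<open>The circle with centre \<open>c\<close> and radius \<open>r > 0\<close>, parametrised by arc length, so that an
  interval of length \<open>l < 2 * pi * r\<close> is mapped to an arc of length \<open>l\<close>.\<close>

definition circle_point :: "complex \<Rightarrow> real \<Rightarrow> real \<Rightarrow> complex" where
  "circle_point c r t = c + complex_of_real r * cis (t / r)"

definition closed_arc :: "complex \<Rightarrow> real \<Rightarrow> real \<Rightarrow> real \<Rightarrow> complex set" where
  "closed_arc c r s l = circle_point c r ` {s..s + l}"

definition open_arc :: "complex \<Rightarrow> real \<Rightarrow> real \<Rightarrow> real \<Rightarrow> complex set" where
  "open_arc c r s l = circle_point c r ` {s<..<s + l}"

definition is_closed_arc :: "complex \<Rightarrow> real \<Rightarrow> complex set \<Rightarrow> bool" where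
  "is_closed_arc c r A \<longleftrightarrow> (\<exists>s l. 0 < l \<and> l < 2 * pi * r \<and> A = closed_arc c r s l)"

definition is_open_arc :: "complex \<Rightarrow> real \<Rightarrow> complex set \<Rightarrow> bool" where
  "is_open_arc c r A \<longleftrightarrow> (\<exists>s l. 0 < l \<and> l < 2 * pi * r \<and> A = open_arc c r s l)"

definition has_arc_length :: "complex \<Rightarrow> real \<Rightarrow> complex set \<Rightarrow> real \<Rightarrow> bool" where
  "has_arc_length c r A l \<longleftrightarrow>
     0 < l \<and> l < 2 * pi * r \<and> (\<exists>s. A = closed_arc c r s l \<or> A = open_arc c r s l)"

definition arc_end_points :: "complex \<Rightarrow> real \<Rightarrow> complex set \<Rightarrow> complex set" where
  "arc_end_points c r A =
     \<Union> {{circle_point c r s, circle_point c r (s + l)} | s l.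
         0 < l \<and> l < 2 * pi * r \<and> (A = closed_arc c r s l \<or> A = open_arc c r s l)}"

definition intersection_graph :: "'a set set \<Rightarrow> 'a set graph" where
  "intersection_graph \<A> =
     \<lparr>verts = \<A>, adj = (\<lambda>A B. A \<in> \<A> \<and> B \<in> \<A> \<and> A \<noteq> B \<and> A \<inter> B \<noteq> {})\<rparr>"

text \<open>The arcs of a model are either all closed or all open.  Mixing both kinds would change the
  class of unit Helly circular-arc graphs: on a circle of circumference 2, the wheel \<open>W\<^sub>4\<close> is
  represented by the closed upper and lower half circles (a rim vertex and the hub), the open
  lower half circle, and the two complementary half-open half circles around the points where
  upper and lower half meet.\<close>

definition circular_arc_model :: "'a graph \<Rightarrow> complex \<Rightarrow> real \<Rightarrow> complex set set \<Rightarrow> bool" where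
  "circular_arc_model G c r \<A> \<longleftrightarrow>
     r > 0 \<and>
     ((\<forall>A\<in>\<A>. is_closed_arc c r A) \<or> (\<forall>A\<in>\<A>. is_open_arc c r A)) \<and>
     graph_isomorphic G (intersection_graph \<A>)"

definition unit_arcs :: "complex \<Rightarrow> real \<Rightarrow> complex set set \<Rightarrow> bool" where
  "unit_arcs c r \<A> \<longleftrightarrow> (\<forall>A\<in>\<A>. has_arc_length c r A 1)"

definition Helly :: "'a set set \<Rightarrow> bool" where
  "Helly \<A> \<longleftrightarrow>
     (\<forall>\<A>'\<subseteq>\<A>. (\<forall>A\<in>\<A>'. \<forall>B\<in>\<A>'. A \<inter> B \<noteq> {}) \<longrightarrow> \<Inter> \<A>' \<noteq> {})"

definition unit_Helly_circular_arc_graph :: "'a graph \<Rightarrow> bool" where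
  "unit_Helly_circular_arc_graph G \<longleftrightarrow>
     (\<exists>c r \<A>. circular_arc_model G c r \<A> \<and> unit_arcs c r \<A> \<and> Helly \<A>)"


section \<open>The generic circular triangle-free graph\<close>

text \<open>Being at a rational angle means that one of the real determinations of the oriented angle
  is rational.  No dense subset of the circle has all its pairwise angles rational when angles
  are normalised to the interval from 0 to \<open>pi\<close>: three points not contained in a half circle
  have such angles summing to \<open>2 * pi\<close>.\<close>

definition generic_circle_set :: "complex set \<Rightarrow> bool" where
  "generic_circle_set S \<longleftrightarrow>
     S \<subseteq> sphere 0 1 \<and> countable S \<and> sphere 0 1 \<subseteq> closure S \<and>
     (\<forall>x\<in>S. \<forall>y\<in>S. x \<noteq> y \<longrightarrow> (\<exists>q\<in>\<rat>. y = x * cis q))"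

text \<open>The arcs with end points \<open>x\<close> and \<open>y\<close> on the unit circle are the images under \<open>cis\<close> of the
  intervals from \<open>s\<close> to \<open>s + l\<close> below.\<close>

definition generic_circular_triangle_free_graph :: "complex set \<Rightarrow> complex graph" where
  "generic_circular_triangle_free_graph S =
     \<lparr>verts = S,
      adj = (\<lambda>x y. x \<in> S \<and> y \<in> S \<and> x \<noteq> y \<and>
        (\<forall>s l. 0 < l \<and> l < 2 * pi \<and> {cis s, cis (s + l)} = {x, y} \<longrightarrow> l > (2 * pi) / 3))\<rparr>"

lemma generic_circle_set_exists: "generic_circle_set (cis ` \<rat>)"
  unfolding generic_circle_set_def
proof (intro conjI ballI impI)
  show "cis ` \<rat> \<subseteq> sphere 0 1" by auto
  show "countable (cis ` \<rat>)" by (simp add: countable_rat)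
  show "sphere 0 1 \<subseteq> closure (cis ` \<rat>)"
  proof
    fix z :: complex assume "z \<in> sphere 0 1"
    then have "z \<noteq> 0" "norm z = 1" by auto
    then have z: "z = cis (Arg z)" by (simp add: cis_Arg sgn_div_norm)
    have "cis ` closure \<rat> \<subseteq> closure (cis ` \<rat>)"
      by (rule image_closure_subset) (auto intro!: continuous_intros closure_subset)
    moreover have "closure \<rat> = (UNIV :: real set)"
      by (rule Rats_closure_real)
    ultimately show "z \<in> closure (cis ` \<rat>)" using z by (metis UNIV_I image_subset_iff)
  qed
next
  fix x y assume "x \<in> cis ` \<rat>" "y \<in> cis ` \<rat>"
  then obtain p q :: real where "p \<in> \<rat>" "q \<in> \<rat>" "x = cis p" "y = cis q" by auto
  then show "\<exists>q\<in>\<rat>. y = x * cis q"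
    by (intro bexI[of _ "q - p"]) (auto simp: cis_mult)
qed

end

theory Submission
  imports Defs "HOL-Real_Asymp.Real_Asymp"
begin

text \<open>
The heart is the passage from forbidden subgraphs to an embedding of the complement \<open>H\<close> of \<open>G\<close> into
the generic circular triangle-free graph.  Suppose \<open>H\<close> is represented on a circle of circumference
3, with adjacency at distance more than 1, and cut the circle at the point of some vertex into
thirds numbered 0, 1, 2.  If the thirds are superposed, then \<open>u\<close> and \<open>v\<close> are adjacent iff \<open>v\<close> is in
the third after that of \<open>u\<close> and at a later position, or conversely.  So a representation amounts to a
colouring of the vertices by thirds and a linear order.  Given the colouring, the order has to extend
a tripartite tournament, and such a tournament is acyclic as soon as it has no cyclic triangle and no
alternating 4-cycle between two parts (\<open>acyclic_multipartite_tournament\<close>).  Together with the base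
vertex these short cycles are configurations of at most five vertices in \<open>H\<close>, so what is left is to
find the colouring.  The neighbours of the base vertex form the middle third, and its non-neighbours
have to be divided between the two other ones (\<open>admissible_sides_if_edge\<close>,
\<open>admissible_sides_if_no_edge\<close>): this is where the forbidden graphs are used.  The argument works
directly for infinite graphs.  Finally a countable order embeds into the positions that the dense set
\<open>S\<close> provides in each third (\<open>strict_order_embeds_in_dense_sets\<close>).

From an embedding, unit arcs starting at the given points form a model by closed arcs
(\<open>generic_imp_disjoint_end_points\<close>); that end points do not coincide means that no two points of \<open>S\<close> are
a third of a turn apart, which holds because \<open>pi\<close> is irrational.  Such a model is Helly
(\<open>disjoint_end_points_imp_Helly\<close>): arcs that meet pairwise can be lifted to the line, where the supremum
of their left ends is a common point.

In a Helly model of unit arcs, all meetings of arcs around the hub of a wheel happen inside the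
hub, so that the rim is a unit interval graph (\<open>rim_is_unit_interval_graph\<close>); chordless cycles
of length 4 or 5 are not.  The complement of the 6-cycle is a prism; of three arcs through a common point
one is covered by the two others (\<open>unit_arcs_common_point_cover\<close>), so every arc that meets it meets
one of them.
\<close>

section \<open>Irrationality of \<open>pi\<close>\<close>

text \<open>The proof is the one of Laczkovich.  The series is the confluent hypergeometric limit function
\<open>0F1(; k; -y)\<close>; at \<open>k = 1/2\<close> and \<open>k = 3/2\<close> it is a cosine and a sine quotient.\<close>

definition bessel_term :: "real \<Rightarrow> real \<Rightarrow> nat \<Rightarrow> real" where
  "bessel_term y k n = (- y) ^ n / (fact n * pochhammer k n)"

definition bessel_series :: "real \<Rightarrow> real \<Rightarrow> real" where
  "bessel_series y k = (\<Sum>n. bessel_term y k n)"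

lemma pochhammer_ge_power:
  fixes k :: real assumes "k > 0" shows "pochhammer k n \<ge> k ^ n"
proof (induction n)
  case (Suc n)
  have "k ^ Suc n \<le> pochhammer k n * k" using Suc assms by (simp add: mult.commute mult_left_mono)
  also have "\<dots> \<le> pochhammer k n * (k + real n)"
    using assms by (intro mult_left_mono) (auto simp: pochhammer_nonneg)
  finally show ?case by (simp add: pochhammer_Suc)
qed simp

lemma abs_bessel_term_le:
  assumes "k > 0" shows "\<bar>bessel_term y k n\<bar> \<le> (\<bar>y\<bar> / k) ^ n / fact n"
proof -
  have p: "0 < pochhammer k n" using assms by (simp add: pochhammer_pos)
  have "\<bar>bessel_term y k n\<bar> = \<bar>y\<bar> ^ n / (fact n * pochhammer k n)"
    unfolding bessel_term_def using p by (simp add: abs_mult power_abs)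
  also have "\<dots> \<le> \<bar>y\<bar> ^ n / (fact n * k ^ n)"
    using assms p pochhammer_ge_power[OF assms, of n]
    by (intro divide_left_mono mult_left_mono mult_pos_pos) auto
  finally show ?thesis by (simp add: power_divide mult.commute)
qed

lemma summable_exp_real: "summable (\<lambda>n. (x::real) ^ n / fact n)"
  using summable_exp_generic[of x] by (simp add: divide_inverse mult.commute)

lemma summable_bessel_term:
  assumes "k > 0" shows "summable (bessel_term y k)"
  by (rule summable_comparison_test'[OF summable_exp_real[of "\<bar>y\<bar> / k"], of 0])
    (use abs_bessel_term_le[OF assms] in auto)

lemma bessel_series_recurrence:
  assumes "k > 0"
  shows "bessel_series y k = bessel_series y (k + 1) - y / (k * (k + 1)) * bessel_series y (k + 2)"
proof -
  have diff: "bessel_term y k (Suc n) - bessel_term y (k + 1) (Suc n) =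
      - (y / (k * (k + 1))) * bessel_term y (k + 2) n" for n
  proof -
    define p where "p = pochhammer (k + 2) n"
    have "p > 0" unfolding p_def using assms by (simp add: pochhammer_pos)
    have p2: "pochhammer (k + 2) n * (k + 1) = pochhammer (k + 1) n * (k + 1 + n)"
      using pochhammer_rec[of "k + 1" n] pochhammer_rec'[of "k + 1" n]
      by (simp add: algebra_simps)
    have a: "pochhammer k (Suc n) = k * (pochhammer (k + 1) n)" by (simp add: pochhammer_rec)
    have b: "pochhammer (k + 1) (Suc n) = (k + 1) * p"
      unfolding p_def using pochhammer_rec[of "k + 1" n] by (simp add: add.assoc)
    have c: "pochhammer (k + 1) n = (k + 1) * p / (k + 1 + n)"
      unfolding p_def using p2 assms by (simp add: field_simps)
    define F :: real where "F = fact n"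
    have "F > 0" unfolding F_def by simp
    have F: "fact (Suc n) = (1 + real n) * F" unfolding F_def by (simp add: algebra_simps)
    have kn: "k + 1 + n > 0" "k + 1 > 0" "1 + real n > 0" using assms by auto
    have "bessel_term y k (Suc n) = (- y) ^ Suc n * (k + 1 + n) / ((1 + n) * F * (k * (k + 1) * p))"
      unfolding bessel_term_def a c F using kn by simp
    moreover have "bessel_term y (k + 1) (Suc n) = (- y) ^ Suc n * k / ((1 + n) * F * (k * (k + 1) * p))"
      unfolding bessel_term_def b F using assms by simp
    ultimately have "bessel_term y k (Suc n) - bessel_term y (k + 1) (Suc n) =
        (- y) ^ Suc n * (1 + n) / ((1 + n) * F * (k * (k + 1) * p))"
      by (simp only: diff_divide_distrib[symmetric] right_diff_distrib[symmetric]) simp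
    also have "\<dots> = - (y / (k * (k + 1))) * bessel_term y (k + 2) n"
      unfolding bessel_term_def p_def[symmetric] F_def[symmetric] using kn by simp
    finally show ?thesis .
  qed
  have s: "summable (bessel_term y k)" "summable (bessel_term y (k + 1))" "summable (bessel_term y (k + 2))"
    using summable_bessel_term assms by auto
  have "bessel_series y k - bessel_series y (k + 1) =
      (\<Sum>n. bessel_term y k n - bessel_term y (k + 1) n)"
    unfolding bessel_series_def using s by (intro suminf_diff)
  also have "\<dots> = (\<Sum>n. bessel_term y k (Suc n) - bessel_term y (k + 1) (Suc n))"
    using suminf_split_head[OF summable_diff[OF s(1,2)]] by (simp add: bessel_term_def)
  also have "\<dots> = - (y / (k * (k + 1))) * bessel_series y (k + 2)"
    unfolding diff bessel_series_def using s(3) by (rule suminf_mult)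
  finally show ?thesis by simp
qed

text \<open>For large \<open>k\<close> the series is dominated by its constant term 1.\<close>

lemma bessel_series_bounds:
  assumes "k > 0" "\<bar>y\<bar> / k \<le> 1/4"
  shows "0 < bessel_series y k" "bessel_series y k \<le> 2"
proof -
  have s: "summable (bessel_term y k)" using summable_bessel_term assms by auto
  have "\<bar>bessel_term y k (Suc n)\<bar> \<le> (1/4) ^ Suc n" for n
  proof -
    have "\<bar>bessel_term y k (Suc n)\<bar> \<le> (\<bar>y\<bar> / k) ^ Suc n / fact (Suc n)"
      using abs_bessel_term_le assms by blast
    also have "\<dots> \<le> (\<bar>y\<bar> / k) ^ Suc n / 1"
      using assms fact_ge_1[of "Suc n", where ?'a = real] by (intro divide_left_mono) (auto simp del: fact_Suc)
    also have "\<dots> \<le> (1/4) ^ Suc n" using assms by (simp add: power_mono del: power_Suc)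
    finally show ?thesis .
  qed
  moreover have "(\<lambda>n. (1/4::real) ^ Suc n) sums (1/3)"
    using sums_mult[OF geometric_sums[of "1/4::real"], of "1/4"] by simp
  ultimately have "\<bar>\<Sum>n. bessel_term y k (Suc n)\<bar> \<le> 1/3"
    using norm_suminf_le[of "\<lambda>n. bessel_term y k (Suc n)" "\<lambda>n. (1/4) ^ Suc n"] by (simp add: sums_iff)
  moreover have "bessel_series y k = 1 + (\<Sum>n. bessel_term y k (Suc n))"
    unfolding bessel_series_def using suminf_split_head[OF s] by (simp add: bessel_term_def)
  ultimately show "0 < bessel_series y k" "bessel_series y k \<le> 2" by linarith+
qed

lemma bessel_series_cos: "bessel_series ((x / 2)\<^sup>2) (1/2) = cos x"
proof -
  have "bessel_term ((x / 2)\<^sup>2) (1/2) n = (- 1) ^ n / fact (2 * n) * x ^ (2 * n)" for n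
    unfolding bessel_term_def fact_double power_mult
    by (simp add: power_divide power_minus[of "x\<^sup>2 / 4"] mult_ac del: power_mult power_even_eq)
  then have "bessel_term ((x / 2)\<^sup>2) (1/2) = (\<lambda>n. (- 1) ^ n / fact (2 * n) * x ^ (2 * n))" by blast
  then show ?thesis
    unfolding bessel_series_def using sums_unique[OF cos_paired[of x]] by simp
qed

lemma bessel_series_sin: "x * bessel_series ((x / 2)\<^sup>2) (3/2) = sin x"
proof -
  have "x * bessel_term ((x / 2)\<^sup>2) (3/2) n = (- 1) ^ n / fact (2 * n + 1) * x ^ (2 * n + 1)" for n
  proof -
    have "pochhammer (1/2) (Suc n) = (1/2) * pochhammer (3/2::real) n"
      using pochhammer_rec[of "1/2::real" n] by simp
    then have p: "pochhammer (3/2::real) n = pochhammer (1/2) n * (2 * n + 1)"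
      by (simp add: pochhammer_Suc field_simps)
    have f: "fact (2 * n + 1) = (2 * n + 1) * (2 ^ (2 * n) * pochhammer (1/2) n * fact n :: real)"
      using fact_double[of n, where 'a = real] by simp
    show ?thesis
      unfolding bessel_term_def f p power_add power_mult
      by (simp add: power_divide power_minus[of "x\<^sup>2 / 4"] mult_ac)
  qed
  then have "(\<lambda>n. x * bessel_term ((x / 2)\<^sup>2) (3/2) n) sums sin x"
    using sin_paired[of x] by simp
  moreover have "(\<lambda>n. x * bessel_term ((x / 2)\<^sup>2) (3/2) n) sums (x * bessel_series ((x / 2)\<^sup>2) (3/2))"
    unfolding bessel_series_def by (intro sums_mult summable_sums summable_bessel_term) simp
  ultimately show ?thesis using sums_unique2 by blast
qed

text \<open>With \<open>y = (pi/4)\<^sup>2\<close> the values \<open>B j\<close> of the series at \<open>k = 1/2 + j\<close> start with \<open>cos (pi/2) = 0\<close>.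
If \<open>pi\<close> were rational, dividing by \<open>B 1\<close> and scaling by \<open>c\<^sup>j\<close> over a Pochhammer symbol would
turn the recurrence into one with integer coefficients and integer initial values.  But the scaled values are
eventually positive and tend to 0.\<close>

theorem pi_irrational: "pi \<notin> \<rat>"
proof
  assume "pi \<in> \<rat>"
  define y where "y = (pi / 4)\<^sup>2"
  define B where "B j = bessel_series y (1/2 + real j)" for j
  have "y > 0" unfolding y_def by simp
  have B0: "B 0 = 0" and B1: "B 1 = 2 / pi"
    using bessel_series_cos[of "pi / 2"] bessel_series_sin[of "pi / 2"]
    unfolding B_def y_def by (simp_all add: field_simps)
  have "1 / y \<in> \<rat>" using \<open>pi \<in> \<rat>\<close> unfolding y_def by simp
  then obtain a b :: int where ab: "1 / y = of_int a / of_int b" "b > 0"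
    by (auto elim!: Rats_cases')
  \<comment> \<open>The factor 2 cancels the denominator of \<open>k = 1/2 + j\<close>, and \<open>b\<close> that of \<open>1 / y\<close>.\<close>
  define c :: real where "c = 2 * of_int b"
  define g where "g j = c ^ j / pochhammer (1/2) j * B j / B 1" for j
  have "c > 0" using ab unfolding c_def by simp
  have p: "pochhammer (1/2 :: real) j > 0" for j by (simp add: pochhammer_pos)
  have g_rec: "g (Suc (Suc j)) = of_int (a * (1 + 2 * int j)) * g (Suc j) - of_int (4 * a * b) * g j" for j
  proof -
    define k :: real where "k = 1/2 + real j"
    have "k > 0" unfolding k_def by simp
    have "B j = B (Suc j) - y / (k * (k + 1)) * B (Suc (Suc j))"
      using bessel_series_recurrence[OF \<open>k > 0\<close>, of y] unfolding B_def k_def by (simp add: algebra_simps)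
    then have "k * (k + 1) * (B (Suc j) - B j) = y * B (Suc (Suc j))"
      using \<open>k > 0\<close> by simp
    then have r: "B (Suc (Suc j)) = k * (k + 1) * (B (Suc j) - B j) / y"
      using \<open>y > 0\<close> by simp
    have q: "pochhammer (1/2) (Suc (Suc j)) = pochhammer (1/2) j * k * (k + 1)"
        "pochhammer (1/2) (Suc j) = pochhammer (1/2) j * k"
      unfolding k_def by (simp_all add: pochhammer_Suc algebra_simps)
    have "g (Suc (Suc j)) = c * k / y * g (Suc j) - c\<^sup>2 / y * g j"
    proof -
      have "g (Suc (Suc j)) = c\<^sup>2 * c ^ j / pochhammer (1/2) j * (B (Suc j) - B j) / y / B 1"
        unfolding g_def r q using \<open>k > 0\<close> by (simp add: power2_eq_square mult_ac)
      moreover have "c * k / y * g (Suc j) = c\<^sup>2 * c ^ j / pochhammer (1/2) j * B (Suc j) / y / B 1"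
        unfolding g_def q using \<open>k > 0\<close> by (simp add: power2_eq_square mult_ac)
      moreover have "c\<^sup>2 / y * g j = c\<^sup>2 * c ^ j / pochhammer (1/2) j * B j / y / B 1"
        unfolding g_def by (simp add: mult_ac)
      ultimately show ?thesis by (simp add: right_diff_distrib diff_divide_distrib)
    qed
    moreover have "c * k / y = c * k * (of_int a / of_int b)" "c\<^sup>2 / y = c\<^sup>2 * (of_int a / of_int b)"
      unfolding ab(1)[symmetric] by simp_all
    moreover have "c * k * (of_int a / of_int b) = of_int (a * (1 + 2 * int j))"
        "c\<^sup>2 * (of_int a / of_int b) = of_int (4 * a * b)"
      unfolding c_def k_def using ab(2) by (simp_all add: field_simps power2_eq_square)
    ultimately show ?thesis by (simp only:)
  qed
  have g_int: "g j \<in> \<int> \<and> g (Suc j) \<in> \<int>" for j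
  proof (induction j)
    case 0
    have "g (Suc 0) = of_int (4 * b)" unfolding g_def c_def using B1 by simp
    moreover have "g 0 = 0" unfolding g_def using B0 by simp
    ultimately show ?case by (metis Ints_of_int Ints_0)
  next
    case (Suc j)
    then show ?case unfolding g_rec by (intro conjI Ints_diff Ints_mult) auto
  qed
  have half: "fact i / 2 \<le> pochhammer (1/2 :: real) (Suc i)" for i
  proof (induction i)
    case (Suc i)
    have "fact (Suc i) / 2 = fact i / 2 * (1 + real i)" by simp
    also have "\<dots> \<le> pochhammer (1/2) (Suc i) * (1/2 + real (Suc i))"
      using Suc p[of "Suc i"] by (intro mult_mono) auto
    finally show ?case by (simp add: pochhammer_Suc)
  qed simp
  have "eventually (\<lambda>i. y / (1/2 + real (Suc i)) \<le> 1/4) sequentially"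
    by real_asymp
  then have g_bounds: "eventually (\<lambda>i. 0 < g (Suc i) \<and> g (Suc i) \<le> 4 * c / B 1 * (c ^ i / fact i)) sequentially"
  proof eventually_elim
    case (elim i)
    have B: "0 < B (Suc i)" "B (Suc i) \<le> 2"
      using bessel_series_bounds[of "1/2 + real (Suc i)" y] elim \<open>y > 0\<close> unfolding B_def by simp_all
    have "c ^ Suc i / pochhammer (1/2) (Suc i) \<le> c ^ Suc i / (fact i / 2)"
      using half[of i] p[of "Suc i"] \<open>c > 0\<close> by (intro divide_left_mono) auto
    then have "c ^ Suc i / pochhammer (1/2) (Suc i) * B (Suc i) \<le> c ^ Suc i / (fact i / 2) * 2"
      using B \<open>c > 0\<close> by (intro mult_mono) auto
    then have "g (Suc i) \<le> c ^ Suc i / (fact i / 2) * 2 / B 1"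
      unfolding g_def using B1 by (intro divide_right_mono) auto
    then show ?case
      using B B1 p[of "Suc i"] \<open>c > 0\<close> unfolding g_def by (simp add: mult_ac)
  qed
  have "(\<lambda>i. 4 * c / B 1 * (c ^ i / fact i)) \<longlonglongrightarrow> 0"
    by (intro tendsto_mult_right_zero summable_LIMSEQ_zero summable_exp_real)
  then have "eventually (\<lambda>i. 4 * c / B 1 * (c ^ i / fact i) < 1) sequentially"
    by (rule order_tendstoD) simp
  with g_bounds have "eventually (\<lambda>i. 0 < g (Suc i) \<and> g (Suc i) < 1) sequentially"
    by eventually_elim auto
  then obtain j where "0 < g (Suc j)" "g (Suc j) < 1"
    using eventually_happens' sequentially_bot by blast
  then show False using g_int[of j] by (auto elim!: Ints_cases)
qed

section \<open>The two sides of a base vertex\<close>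

text \<open>The complement of \<open>W\<^sub>4\<close> is two disjoint edges and an isolated vertex, that of \<open>W\<^sub>5\<close> is a
5-cycle and an isolated vertex.  The locale forbids the four graphs in terms of the complement, whose
adjacency is \<open>h\<close>.  The configurations are given by adjacencies alone, since a coincidence of
vertices or a short chord would produce a triangle or violate one of the listed non-adjacencies.\<close>

locale obstruction_free_graph =
  fixes V :: "'a set" and h :: "'a \<Rightarrow> 'a \<Rightarrow> bool"
  assumes h_verts: "h x y \<Longrightarrow> x \<in> V"
    and h_sym: "h x y \<Longrightarrow> h y x"
    and h_irrefl: "\<not> h x x"
    and no_K3: "\<lbrakk>h x y; h y z; h x z\<rbrakk> \<Longrightarrow> False"
    and no_2K2_K1: "\<lbrakk>h a b; h c d; \<not> h a c; \<not> h a d; \<not> h b c; \<not> h b d;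
        x \<in> V; \<not> h x a; \<not> h x b; \<not> h x c; \<not> h x d\<rbrakk> \<Longrightarrow> False"
    and no_C5_K1: "\<lbrakk>h a b; h b c; h c d; h d e; h e a;
        x \<in> V; \<not> h x a; \<not> h x b; \<not> h x c; \<not> h x d; \<not> h x e\<rbrakk> \<Longrightarrow> False"
    and no_C6: "\<lbrakk>h a b; h b c; h c d; h d e; h e f; h f a; \<not> h a d; \<not> h b e; \<not> h c f\<rbrakk> \<Longrightarrow> False"
begin

text \<open>Everything is measured from a base vertex \<open>o\<^sub>0\<close>, which counts among its own non-neighbours.  In
a circular representation the non-neighbours of \<open>o\<^sub>0\<close> lie within a third of the circle
before or after \<open>o\<^sub>0\<close>, and the neighbours of \<open>o\<^sub>0\<close> in the opposite third.  A non-neighbour on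
the one side is adjacent to an initial part of the opposite third, one on the other side to a
final part.  Hence two non-neighbours with incomparable sets of neighbours there
(\<open>crossing\<close>) lie on different sides, and two non-adjacent ones that both miss a
neighbour of \<open>o\<^sub>0\<close> (\<open>jointly_miss\<close>) lie on the same side.\<close>

definition non_nbrs :: "'a \<Rightarrow> 'a set" where
  "non_nbrs o\<^sub>0 = {v \<in> V. \<not> h o\<^sub>0 v}"

definition jointly_miss :: "'a \<Rightarrow> 'a \<Rightarrow> 'a \<Rightarrow> bool" where
  "jointly_miss o\<^sub>0 u v \<longleftrightarrow> (\<exists>n. h o\<^sub>0 n \<and> \<not> h u n \<and> \<not> h v n)"

definition crossing :: "'a \<Rightarrow> 'a \<Rightarrow> 'a \<Rightarrow> bool" where
  "crossing o\<^sub>0 u v \<longleftrightarrow>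
     (\<exists>n m. h o\<^sub>0 n \<and> h o\<^sub>0 m \<and> h u n \<and> \<not> h v n \<and> h v m \<and> \<not> h u m)"

definition admissible_sides :: "'a \<Rightarrow> ('a \<Rightarrow> bool) \<Rightarrow> bool" where
  "admissible_sides o\<^sub>0 \<sigma> \<longleftrightarrow>
     (\<forall>u\<in>non_nbrs o\<^sub>0. \<forall>v\<in>non_nbrs o\<^sub>0.
        (h u v \<or> crossing o\<^sub>0 u v \<longrightarrow> \<sigma> u \<noteq> \<sigma> v) \<and>
        (\<not> h u v \<and> jointly_miss o\<^sub>0 u v \<longrightarrow> \<sigma> u = \<sigma> v))"

lemma edges_of_non_nbrs_touch:
  assumes "o\<^sub>0 \<in> V" "a \<in> non_nbrs o\<^sub>0" "b \<in> non_nbrs o\<^sub>0" "c \<in> non_nbrs o\<^sub>0" "d \<in> non_nbrs o\<^sub>0"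
    and "h a b" "h c d"
  shows "h a c \<or> h a d \<or> h b c \<or> h b d"
  using assms no_2K2_K1[of a b c d o\<^sub>0] unfolding non_nbrs_def by blast

lemma no_closed_5_walk_in_non_nbrs:
  assumes "o\<^sub>0 \<in> V" "a \<in> non_nbrs o\<^sub>0" "b \<in> non_nbrs o\<^sub>0" "c \<in> non_nbrs o\<^sub>0" "d \<in> non_nbrs o\<^sub>0"
      "e \<in> non_nbrs o\<^sub>0"
    and "h a b" "h b c" "h c d" "h d e" "h e a"
  shows False
  using assms no_C5_K1[of a b c d e o\<^sub>0] unfolding non_nbrs_def by blast

text \<open>A vertex \<open>i\<close> without neighbours among the non-neighbours of \<open>o\<^sub>0\<close> gets its side from an edge
\<open>a b\<close> whose ends are on different sides: one of the ends misses \<open>n\<close> as well, because there are no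
triangles, and if both ends jointly missed a neighbour of \<open>o\<^sub>0\<close> with \<open>i\<close>, then these neighbours
would form with \<open>a\<close>, \<open>b\<close> and \<open>o\<^sub>0\<close> a 5-cycle that \<open>i\<close> does not touch.\<close>

lemma isolated_misses_with_one_end:
  assumes o: "o\<^sub>0 \<in> V" and i: "i \<in> non_nbrs o\<^sub>0" "\<forall>t\<in>non_nbrs o\<^sub>0. \<not> h i t"
    and ab: "a \<in> non_nbrs o\<^sub>0" "b \<in> non_nbrs o\<^sub>0" "h a b"
    and n: "h o\<^sub>0 n" "\<not> h i n"
  shows "jointly_miss o\<^sub>0 i a \<longleftrightarrow> \<not> jointly_miss o\<^sub>0 i b"
proof -
  have iV: "i \<in> V" and na: "\<not> h i a" "\<not> h i b" "\<not> h i o\<^sub>0" "\<not> h o\<^sub>0 a" "\<not> h o\<^sub>0 b"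
    using i ab h_sym unfolding non_nbrs_def by blast+
  have "jointly_miss o\<^sub>0 i a \<or> jointly_miss o\<^sub>0 i b"
    unfolding jointly_miss_def using n no_K3 ab(3) h_sym by meson
  moreover have False if mm: "jointly_miss o\<^sub>0 i a" "jointly_miss o\<^sub>0 i b"
  proof -
    obtain p q where p: "h o\<^sub>0 p" "\<not> h i p" "\<not> h a p" and q: "h o\<^sub>0 q" "\<not> h i q" "\<not> h b q"
      using mm unfolding jointly_miss_def by blast
    have "h b p"
      using no_2K2_K1[of a b o\<^sub>0 p i] ab(3) p na iV h_sym by blast
    moreover have "h a q"
      using no_2K2_K1[of a b o\<^sub>0 q i] ab(3) q na iV h_sym by blast
    ultimately show False
      using no_C5_K1[of a q o\<^sub>0 p b i] ab(3) p q na iV h_sym by blast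
  qed
  ultimately show ?thesis by blast
qed

text \<open>The non-neighbours of \<open>o\<^sub>0\<close> induce a bipartite graph in which any two disjoint edges are joined by
an edge, so the ones that are not isolated there form a connected graph, and two of them on the same
side share a neighbour.
Their sides are the colour classes: \<open>\<sigma>\<close> asks for a common neighbour with \<open>u\<close>.  The isolated
ones are put on the side of \<open>u\<close> if they miss a neighbour of \<open>o\<^sub>0\<close> jointly with \<open>u\<close>.\<close>

lemma admissible_sides_if_edge:
  assumes o: "o\<^sub>0 \<in> V" and uv: "u \<in> non_nbrs o\<^sub>0" "v \<in> non_nbrs o\<^sub>0" "h u v"
  shows "\<exists>\<sigma>. admissible_sides o\<^sub>0 \<sigma>"
proof -
  let ?M = "non_nbrs o\<^sub>0"
  define joined where "joined w x \<longleftrightarrow> (\<exists>t\<in>?M. h w t \<and> h t x)" for w x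
  define iso where "iso w \<longleftrightarrow> (\<forall>t\<in>?M. \<not> h w t)" for w
  define \<sigma> where "\<sigma> w \<longleftrightarrow> joined w u \<or> (iso w \<and> jointly_miss o\<^sub>0 w u)" for w
  note touch = edges_of_non_nbrs_touch[OF o]
  note no5 = no_closed_5_walk_in_non_nbrs[OF o]
  have vu: "h v u" using uv h_sym by blast
  have MD: "w \<in> V" "\<not> h o\<^sub>0 w" "\<not> h w o\<^sub>0" if "w \<in> ?M" for w
    using that h_sym unfolding non_nbrs_def by blast+
  \<comment> \<open>A common neighbour with both ends of the edge closes a 5-cycle.\<close>
  have not_both: "\<not> joined w v" if w: "w \<in> ?M" "joined w u" for w
  proof
    assume "joined w v"
    then obtain s t where "s \<in> ?M" "h w s" "h s v" "t \<in> ?M" "h w t" "h t u"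
      using w(2) unfolding joined_def by blast
    then show False using no5[of w s v u t] w(1) uv vu h_sym by blast
  qed
  have either: "joined w u \<or> joined w v" if w: "w \<in> ?M" "\<not> iso w" for w
  proof -
    obtain t where t: "t \<in> ?M" "h w t" using w(2) unfolding iso_def by blast
    then consider "h w u" | "h w v" | "h t u" | "h t v"
      using touch[of w t u v] w(1) uv by blast
    then show ?thesis
      unfolding joined_def using t uv vu by cases blast+
  qed
  have \<sigma>_joined: "\<sigma> w \<longleftrightarrow> joined w u" "\<sigma> w \<longleftrightarrow> \<not> joined w v" if "w \<in> ?M" "\<not> iso w" for w
    using that either not_both unfolding \<sigma>_def by blast+
  have \<sigma>_iso: "\<sigma> w \<longleftrightarrow> jointly_miss o\<^sub>0 w u" if "iso w" for w
    using that h_sym unfolding \<sigma>_def joined_def iso_def by blast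
  have edge: "\<sigma> w \<noteq> \<sigma> z" if w: "w \<in> ?M" "z \<in> ?M" "h w z" for w z
  proof -
    have ni: "\<not> iso w" "\<not> iso z" using w h_sym unfolding iso_def by blast+
    have *: False if j: "joined w x" "joined z x" "x \<in> ?M" for x
    proof -
      obtain s t where "s \<in> ?M" "h w s" "h s x" "t \<in> ?M" "h z t" "h t x"
        using j unfolding joined_def by blast
      then show False using no5[of w s x t z] w j(3) h_sym by blast
    qed
    then show ?thesis using \<sigma>_joined[OF w(1) ni(1)] \<sigma>_joined[OF w(2) ni(2)] uv by blast
  qed
  have nbr: "\<exists>t\<in>?M. h w t \<and> \<sigma> t \<noteq> \<sigma> w \<and> \<not> iso t" if w: "w \<in> ?M" "\<not> iso w" for w
    using w edge h_sym unfolding iso_def by blast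
  have common: "\<exists>t\<in>?M. h w t \<and> h z t"
    if w: "w \<in> ?M" "z \<in> ?M" "\<not> iso w" "\<not> iso z" "\<sigma> w = \<sigma> z" for w z
  proof -
    obtain s t where st: "s \<in> ?M" "h w s" "\<sigma> s \<noteq> \<sigma> w" "t \<in> ?M" "h z t" "\<sigma> t \<noteq> \<sigma> z"
      using nbr w by meson
    then have "h w z \<or> h w t \<or> h s z \<or> h s t" using touch[of w s z t] w by blast
    moreover have "\<not> h w z" "\<not> h s t" using edge st w by blast+
    ultimately show ?thesis using st h_sym by blast
  qed
  \<comment> \<open>The side of an isolated vertex can be read off at any non-isolated vertex.\<close>
  have miss_iso: "jointly_miss o\<^sub>0 i w \<longleftrightarrow> (\<sigma> i \<longleftrightarrow> \<sigma> w)"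
    if i: "i \<in> ?M" "iso i" and w: "w \<in> ?M" "\<not> iso w"
      and n: "h o\<^sub>0 n" "\<not> h i n" for i w n
  proof -
    have ex: "jointly_miss o\<^sub>0 i a \<longleftrightarrow> \<not> jointly_miss o\<^sub>0 i b" if "a \<in> ?M" "b \<in> ?M" "h a b" for a b
      using isolated_misses_with_one_end[OF o i(1) _ that n] i(2) unfolding iso_def by blast
    have niuv: "\<not> iso u" "\<not> iso v" using uv vu unfolding iso_def by blast+
    have su: "\<sigma> u" using \<sigma>_joined[OF uv(1) niuv(1)] uv vu unfolding joined_def by blast
    have same: "jointly_miss o\<^sub>0 i w \<longleftrightarrow> jointly_miss o\<^sub>0 i z"
      if "z \<in> ?M" "\<not> iso z" "\<sigma> w = \<sigma> z" for z
      using common[of w z] that w ex by blast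
    show ?thesis
    proof (cases "\<sigma> w")
      case True
      then show ?thesis using same[of u] su niuv uv(1) \<sigma>_iso[OF i(2)] by blast
    next
      case False
      then have "jointly_miss o\<^sub>0 i w \<longleftrightarrow> jointly_miss o\<^sub>0 i v"
        using same[of v] su edge[OF uv] niuv uv(2) by blast
      then show ?thesis using ex[OF uv] False \<sigma>_iso[OF i(2)] by blast
    qed
  qed
  \<comment> \<open>If \<open>w\<close> sees \<open>m\<close>, then a neighbour \<open>t\<close> of \<open>w\<close> misses \<open>m\<close>, so that \<open>i\<close> is on the side of \<open>t\<close>.\<close>
  have iso_crossing: "\<sigma> i \<noteq> \<sigma> w"
    if i: "i \<in> ?M" "iso i" and w: "w \<in> ?M" "\<not> iso w"
      and m: "h o\<^sub>0 m" "h w m" "\<not> h i m" for i w m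
  proof -
    obtain t where t: "t \<in> ?M" "h w t" "\<sigma> t \<noteq> \<sigma> w" "\<not> iso t" using nbr w by blast
    have "\<not> h t m" using no_K3[of w t m] t m by blast
    then have "jointly_miss o\<^sub>0 i t" unfolding jointly_miss_def using m by blast
    then show ?thesis using miss_iso[OF i t(1,4) m(1,3)] t(3) by blast
  qed
  have cross: "\<sigma> w \<noteq> \<sigma> z" if w: "w \<in> ?M" "z \<in> ?M" and c: "crossing o\<^sub>0 w z" for w z
  proof -
    obtain n m where n: "h o\<^sub>0 n" "h w n" "\<not> h z n" and m: "h o\<^sub>0 m" "h z m" "\<not> h w m"
      using c unfolding crossing_def by blast
    consider "\<not> iso w" "\<not> iso z" | "iso w" "\<not> iso z" | "\<not> iso w" "iso z" | "iso w" "iso z" by blast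
    then show ?thesis
    proof cases
      case 1
      show ?thesis
      proof
        assume "\<sigma> w = \<sigma> z"
        then obtain t where "t \<in> ?M" "h w t" "h z t" using common w 1 by blast
        \<comment> \<open>Two crossing vertices with a common neighbour lie with \<open>o\<^sub>0\<close> on an induced 6-cycle.\<close>
        then show False
          using no_C6[of w n o\<^sub>0 m z t] n m h_sym MD w by blast
      qed
    next
      case 2
      then show ?thesis using iso_crossing[of w z m] w m by blast
    next
      case 3
      then show ?thesis using iso_crossing[of z w n] w n by blast
    next
      case 4
      have niuv: "\<not> iso u" "\<not> iso v" using uv vu unfolding iso_def by blast+
      show ?thesis
      proof
        assume eq: "\<sigma> w = \<sigma> z"
        \<comment> \<open>A vertex \<open>x\<close> of the other side sees both witnesses, so a neighbour \<open>y\<close> of \<open>x\<close> sees neither.\<close>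
        obtain x where x: "x \<in> ?M" "\<not> iso x" "\<sigma> x \<noteq> \<sigma> w"
          using uv edge[OF uv] niuv by blast
        have "h x m" "h x n"
          using miss_iso[of w x m] miss_iso[of z x n] 4 w x eq n m
          unfolding jointly_miss_def by blast+
        obtain y where y: "y \<in> ?M" "h x y" using nbr x by blast
        then have "\<not> h y n" "\<not> h y m" using no_K3 \<open>h x m\<close> \<open>h x n\<close> by blast+
        moreover have "\<not> h n m" using no_K3[of o\<^sub>0 n m] n m by blast
        moreover have "\<not> h y w" "\<not> h y z" "\<not> h w z" using 4 y w h_sym unfolding iso_def by blast+
        ultimately show False
          using no_2K2_K1[of w n z m y] n m y MD h_sym by blast
      qed
    qed
  qed
  have miss: "\<sigma> w = \<sigma> z"
    if w: "w \<in> ?M" "z \<in> ?M" "\<not> h w z" and c: "jointly_miss o\<^sub>0 w z" for w z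
  proof -
    obtain n where n: "h o\<^sub>0 n" "\<not> h w n" "\<not> h z n" using c unfolding jointly_miss_def by blast
    have c': "jointly_miss o\<^sub>0 z w" using n unfolding jointly_miss_def by blast
    consider "\<not> iso w" "\<not> iso z" | "iso w" "\<not> iso z" | "\<not> iso w" "iso z" | "iso w" "iso z" by blast
    then show ?thesis
    proof cases
      case 1
      show ?thesis
      proof (rule ccontr)
        assume ne: "\<sigma> w \<noteq> \<sigma> z"
        obtain s t where st: "s \<in> ?M" "h w s" "\<sigma> s \<noteq> \<sigma> w" "t \<in> ?M" "h z t" "\<sigma> t \<noteq> \<sigma> z"
          using nbr w 1 by meson
        have ns: "\<not> h w t" "\<not> h s z" using edge st w ne by blast+
        then have "h s t" using touch[of w s z t] st w by blast
        \<comment> \<open>The edge from \<open>o\<^sub>0\<close> to \<open>n\<close> has to be joined to \<open>w s\<close> and to \<open>z t\<close>, which gives a triangle.\<close>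
        have "h s n"
          using no_2K2_K1[of w s o\<^sub>0 n z] st ns n MD w h_sym by blast
        moreover have "h t n"
          using no_2K2_K1[of z t o\<^sub>0 n w] st ns n MD w h_sym by blast
        ultimately show False using no_K3[of s t n] \<open>h s t\<close> by blast
      qed
    next
      case 2
      then show ?thesis using miss_iso[of w z n] w n c by blast
    next
      case 3
      then show ?thesis using miss_iso[of z w n] w n c' by blast
    next
      case 4
      have niuv: "\<not> iso u" "\<not> iso v" using uv vu unfolding iso_def by blast+
      have "\<not> h u n \<or> \<not> h v n" using no_K3[of u v n] uv by blast
      then obtain x where x: "x \<in> ?M" "\<not> iso x" "\<not> h x n" using uv niuv by blast
      then have "jointly_miss o\<^sub>0 w x" "jointly_miss o\<^sub>0 z x"
        using n unfolding jointly_miss_def by blast+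
      then show ?thesis using miss_iso[of w x n] miss_iso[of z x n] 4 w x n by blast
    qed
  qed
  have "admissible_sides o\<^sub>0 \<sigma>"
    unfolding admissible_sides_def using edge cross miss by blast
  then show ?thesis by blast
qed

text \<open>If the non-neighbours are independent, then only \<open>crossing\<close> can separate them.  A crossing pair
\<open>u\<close>, \<open>v\<close> then plays the part of the edge: together its members see every neighbour of \<open>o\<^sub>0\<close>, and
every non-neighbour that does not see all neighbours of \<open>o\<^sub>0\<close> misses one jointly with exactly one
of \<open>u\<close> and \<open>v\<close>.\<close>

lemma admissible_sides_if_no_edge:
  assumes o: "o\<^sub>0 \<in> V" and indep: "\<And>u v. u \<in> non_nbrs o\<^sub>0 \<Longrightarrow> v \<in> non_nbrs o\<^sub>0 \<Longrightarrow> \<not> h u v"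
  shows "\<exists>\<sigma>. admissible_sides o\<^sub>0 \<sigma>"
proof (cases "\<exists>u\<in>non_nbrs o\<^sub>0. \<exists>v\<in>non_nbrs o\<^sub>0. crossing o\<^sub>0 u v")
  case False
  then have "admissible_sides o\<^sub>0 (\<lambda>_. True)"
    unfolding admissible_sides_def using indep by blast
  then show ?thesis by blast
next
  case True
  let ?M = "non_nbrs o\<^sub>0"
  obtain u v p q where uv: "u \<in> ?M" "v \<in> ?M"
    and p: "h o\<^sub>0 p" "h u p" "\<not> h v p" and q: "h o\<^sub>0 q" "h v q" "\<not> h u q"
    using True unfolding crossing_def by blast
  have MD: "w \<in> V" "\<not> h o\<^sub>0 w" "\<not> h w o\<^sub>0" if "w \<in> ?M" for w
    using that h_sym unfolding non_nbrs_def by blast+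
  have N: "\<not> h n m" if "h o\<^sub>0 n" "h o\<^sub>0 m" for n m using no_K3[of o\<^sub>0 n m] that by blast
  have NV: "n \<in> V" if "h o\<^sub>0 n" for n using h_verts h_sym that by blast
  note miss_def = jointly_miss_def
  have cover: "h u n \<or> h v n" if n: "h o\<^sub>0 n" for n
    using no_2K2_K1[of u p v q n] p q n uv N NV indep h_sym by blast
  have either: "jointly_miss o\<^sub>0 w u \<or> jointly_miss o\<^sub>0 w v"
    if w: "w \<in> ?M" and n: "h o\<^sub>0 n" "\<not> h w n" for w n
  proof (rule ccontr)
    assume no: "\<not> ?thesis"
    then have "h w p" "h w q" "h u n" "h v n" using n p q unfolding miss_def by blast+
    then show False using no_C6[of w p u n v q] n p q h_sym by blast
  qed
  have not_both: False
    if w: "w \<in> ?M" and m: "jointly_miss o\<^sub>0 w u" "jointly_miss o\<^sub>0 w v" for w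
  proof -
    obtain n k where n: "h o\<^sub>0 n" "\<not> h w n" "\<not> h u n" and k: "h o\<^sub>0 k" "\<not> h w k" "\<not> h v k"
      using m unfolding miss_def by blast
    then have "h v n" "h u k" using cover by blast+
    then show False
      using no_2K2_K1[of u k v n w] n k uv w MD N indep h_sym by blast
  qed
  define \<sigma> where "\<sigma> w \<longleftrightarrow> jointly_miss o\<^sub>0 w u" for w
  have \<sigma>: "\<sigma> w \<longleftrightarrow> \<not> jointly_miss o\<^sub>0 w v" if "w \<in> ?M" "h o\<^sub>0 n" "\<not> h w n" for w n
    using either[OF that] not_both that(1) unfolding \<sigma>_def by blast
  have cross: "\<sigma> w \<noteq> \<sigma> z" if w: "w \<in> ?M" "z \<in> ?M" and c: "crossing o\<^sub>0 w z" for w z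
  proof
    assume eq: "\<sigma> w = \<sigma> z"
    obtain a b where a: "h o\<^sub>0 a" "h w a" "\<not> h z a" and b: "h o\<^sub>0 b" "h z b" "\<not> h w b"
      using c unfolding crossing_def by blast
    note side = \<sigma>[OF w(1) b(1,3)] \<sigma>[OF w(2) a(1,3)]
    show False
    proof (cases "\<sigma> w")
      case True
      then have "h v a" "h v b" "h w p" "h z p"
        using side eq a b p unfolding miss_def by blast+
      then show False using no_C6[of v a w p z b] a b p h_sym by blast
    next
      case False
      then have "h u a" "h u b" "h w q" "h z q"
        using eq a b q unfolding \<sigma>_def miss_def by blast+
      then show False using no_C6[of u a w q z b] a b q h_sym by blast
    qed
  qed
  have not_split: False
    if w: "w \<in> ?M" "z \<in> ?M" "\<sigma> w" "\<not> \<sigma> z" and n: "h o\<^sub>0 n" "\<not> h w n" "\<not> h z n" for w z n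
  proof -
    have "h w p" "h v n" using \<sigma>[OF w(1) n(1,2)] w n p unfolding miss_def by blast+
    have "h z q" "h u n" using w n q unfolding \<sigma>_def miss_def by blast+
    have "\<not> h w q"
      using no_C6[of w p u n v q] \<open>h w p\<close> \<open>h v n\<close> \<open>h u n\<close> n p q h_sym by blast
    moreover have "\<not> h z p"
      using no_C6[of z q v n u p] \<open>h z q\<close> \<open>h v n\<close> \<open>h u n\<close> n p q h_sym by blast
    ultimately show False
      using no_2K2_K1[of w p z q n] \<open>h w p\<close> \<open>h z q\<close> n p q w N NV indep h_sym by blast
  qed
  have "admissible_sides o\<^sub>0 \<sigma>"
    unfolding admissible_sides_def using indep cross not_split unfolding miss_def by blast
  then show ?thesis by blast
qed

end

section \<open>Colouring by thirds and linear order\<close>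

text \<open>A cycle in a multipartite tournament can be shortened along an arc between two of its vertices
from different parts, until its length is three or it is a 4-cycle alternating between two parts.
Concretely, \<open>T\<close> together with its two-step paths is already transitive.\<close>

lemma acyclic_multipartite_tournament:
  fixes T :: "'a \<Rightarrow> 'a \<Rightarrow> bool" and col :: "'a \<Rightarrow> 'c"
  assumes parts: "\<And>u v. T u v \<Longrightarrow> u \<in> V \<and> v \<in> V \<and> col u \<noteq> col v"
    and total: "\<And>u v. u \<in> V \<Longrightarrow> v \<in> V \<Longrightarrow> col u \<noteq> col v \<Longrightarrow> T u v \<or> T v u"
    and asym: "\<And>u v. T u v \<Longrightarrow> \<not> T v u"
    and no3: "\<And>u v w. T u v \<Longrightarrow> T v w \<Longrightarrow> \<not> T w u"
    and no4: "\<And>u v w z. \<lbrakk>T u v; T v w; T w z; T z u; col u = col w; col v = col z\<rbrakk> \<Longrightarrow> False"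
  shows "\<exists>R. (\<forall>u. \<not> R u u) \<and> (\<forall>u v w. R u v \<longrightarrow> R v w \<longrightarrow> R u w) \<and> (\<forall>u v. T u v \<longrightarrow> R u v)"
proof -
  let ?R = "\<lambda>u v. T u v \<or> (\<exists>w. T u w \<and> T w v)"
  have step: "?R u z" if t: "T u v" "T v w" "T w z" for u v w z
  proof -
    consider "col u \<noteq> col w" | "col v \<noteq> col z" | "col u = col w" "col v = col z" by blast
    then show ?thesis
    proof cases
      case 1
      then have "T u w" using total[of u w] no3 parts t by blast
      then show ?thesis using t by blast
    next
      case 2
      then have "T v z" using total[of v z] no3 parts t by blast
      then show ?thesis using t by blast
    next
      case 3
      then have "col u \<noteq> col z" using parts[OF t(1)] by simp
      then show ?thesis using total[of u z] no4[OF t] parts t 3 by blast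
    qed
  qed
  have "?R u w" if "?R u v" "?R v w" for u v w
    using that step by meson
  then show ?thesis using asym by (intro exI[of _ ?R]) blast
qed

context obstruction_free_graph begin

lemma ex_admissible_sides:
  assumes "o\<^sub>0 \<in> V" shows "\<exists>\<sigma>. admissible_sides o\<^sub>0 \<sigma>"
  using admissible_sides_if_edge admissible_sides_if_no_edge assms by blast

text \<open>Cut the circle at \<open>o\<^sub>0\<close> into three thirds numbered 0, 1, 2.  The sides and the neighbourhood of
\<open>o\<^sub>0\<close> determine the third \<open>col v\<close> of every vertex, and what remains to be found is the
position within the third.  Superposing the thirds, the point \<open>v\<close> in the third after that of \<open>u\<close> is
adjacent to \<open>u\<close> iff its position is further on than that of \<open>u\<close>.  So adjacency orients all pairs
with different colours, and a representation exists once this tripartite tournament is acyclic.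
Cyclic triangles are triangles or independent triples meeting all thirds; alternating
4-cycles are induced pairs of disjoint edges between two thirds.  Admissible sides exclude those that
the forbidden configurations leave.\<close>

lemma ex_colour_order:
  assumes o: "o\<^sub>0 \<in> V"
  shows "\<exists>(col :: 'a \<Rightarrow> nat) R. (\<forall>v. col v < 3) \<and> (\<forall>u. \<not> R u u) \<and> (\<forall>u v w. R u v \<longrightarrow> R v w \<longrightarrow> R u w) \<and>
     (\<forall>u\<in>V. \<forall>v\<in>V. (col u = col v \<longrightarrow> \<not> h u v) \<and>
        (col v = (col u + 1) mod 3 \<longrightarrow> (if h u v then R u v else R v u)))"
proof -
  obtain \<sigma> where \<sigma>: "admissible_sides o\<^sub>0 \<sigma>" using ex_admissible_sides[OF o] by blast
  define col :: "'a \<Rightarrow> nat" where "col v = (if h o\<^sub>0 v then 1 else if \<sigma> v then 0 else 2)" for v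
  define T where "T u v \<longleftrightarrow> u \<in> V \<and> v \<in> V \<and>
      ((col v = (col u + 1) mod 3 \<and> h u v) \<or> (col u = (col v + 1) mod 3 \<and> \<not> h u v))" for u v
  have cols: "col v = 0 \<or> col v = 1 \<or> col v = 2" for v unfolding col_def by simp
  have c1: "col v = 1 \<longleftrightarrow> h o\<^sub>0 v" for v unfolding col_def by simp
  have side: "(h u v \<longrightarrow> \<sigma> u \<noteq> \<sigma> v) \<and> (crossing o\<^sub>0 u v \<longrightarrow> \<sigma> u \<noteq> \<sigma> v) \<and>
      (\<not> h u v \<and> jointly_miss o\<^sub>0 u v \<longrightarrow> \<sigma> u = \<sigma> v)"
    if "u \<in> V" "v \<in> V" "\<not> h o\<^sub>0 u" "\<not> h o\<^sub>0 v" for u v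
    using \<sigma> that unfolding admissible_sides_def non_nbrs_def by blast
  have same_col: "\<not> h u v" if "u \<in> V" "v \<in> V" "col u = col v" for u v
    using side[of u v] that no_K3[of o\<^sub>0 u v] unfolding col_def by (auto split: if_splits)
  have no_empty: False
    if v: "a \<in> V" "n \<in> V" "b \<in> V" "col a = 0" "col n = 1" "col b = 2" "\<not> h a n" "\<not> h n b" "\<not> h a b" for a n b
  proof -
    have "h o\<^sub>0 n" "\<not> h o\<^sub>0 a" "\<not> h o\<^sub>0 b" "\<sigma> a" "\<not> \<sigma> b" using v unfolding col_def by (auto split: if_splits)
    moreover have "jointly_miss o\<^sub>0 a b" unfolding jointly_miss_def using v calculation h_sym by blast
    ultimately show False using side[of a b] v by blast
  qed
  have no_matching: False
    if v: "a \<in> V" "b \<in> V" "c \<in> V" "d \<in> V" "h a b" "h c d" "\<not> h a d" "\<not> h c b"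
      "col a = col c" "col b = col d" for a b c d
  proof -
    have ac: "\<not> h a c" "\<not> h b d" using same_col v by blast+
    have gen: False if v: "a \<in> V" "c \<in> V" "h a b" "h c d" "\<not> h a d" "\<not> h c b"
      "col a = col c" "h o\<^sub>0 b" "h o\<^sub>0 d" for a b c d
    proof -
      have n: "\<not> h o\<^sub>0 a" "\<not> h o\<^sub>0 c" using no_K3[of o\<^sub>0 a b] no_K3[of o\<^sub>0 c d] v by blast+
      then have "\<sigma> a = \<sigma> c" using v unfolding col_def by (auto split: if_splits)
      moreover have "crossing o\<^sub>0 a c" unfolding crossing_def using v by blast
      ultimately show False using side[of a c] v n by blast
    qed
    consider "h o\<^sub>0 b" | "h o\<^sub>0 a" | "\<not> h o\<^sub>0 a" "\<not> h o\<^sub>0 b" by blast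
    then show False
    proof cases
      case 1
      then have "h o\<^sub>0 d" using c1 v by metis
      then show False using gen[of a c b d] v 1 by blast
    next
      case 2
      then have "h o\<^sub>0 c" using c1 v by metis
      then show False using gen[of b d a c] v 2 h_sym by blast
    next
      case 3
      then have "\<not> h o\<^sub>0 c" "\<not> h o\<^sub>0 d" using c1 v by metis+
      then show False using no_2K2_K1[of a b c d o\<^sub>0] 3 v ac o h_sym by blast
    qed
  qed
  have "\<exists>R. (\<forall>u. \<not> R u u) \<and> (\<forall>u v w. R u v \<longrightarrow> R v w \<longrightarrow> R u w) \<and> (\<forall>u v. T u v \<longrightarrow> R u v)"
  proof (rule acyclic_multipartite_tournament[where V = V and col = col])
    show "u \<in> V \<and> v \<in> V \<and> col u \<noteq> col v" if "T u v" for u v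
      using that cols[of u] cols[of v] unfolding T_def by auto
    have comm: "h u v = h v u" for u v using h_sym by blast
    have cyc: "\<not> (d = (c + 1) mod 3 \<and> c = (d + 1) mod 3)" for c d :: nat by presburger
    have one_way: "\<not> (col v = (col u + 1) mod 3 \<and> col u = (col v + 1) mod 3)" for u v by (rule cyc)
    show "T u v \<or> T v u" if "u \<in> V" "v \<in> V" "col u \<noteq> col v" for u v
      using that cols[of u] cols[of v] comm[of u v] unfolding T_def by auto
    show "\<not> T v u" if "T u v" for u v
      using that one_way comm[of u v] unfolding T_def by blast
    show "\<not> T w u" if t: "T u v" "T v w" for u v w
    proof
      assume t': "T w u"
      consider (up) "col v = (col u + 1) mod 3" "h u v" | (down) "col u = (col v + 1) mod 3" "\<not> h u v"
        using t(1) unfolding T_def by blast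
      then show False
      proof cases
        case up
        have "h v w" "h w u"
          using up t(2) t' cols[of u] cols[of w] unfolding T_def by auto
        then show False using no_K3[of u v w] up h_sym by blast
      next
        case down
        have vw: "col v = (col w + 1) mod 3" "\<not> h v w"
          using down t(2) t' cyc unfolding T_def by metis+
        have wu: "col w = (col u + 1) mod 3" "\<not> h w u"
          using vw down t' cyc unfolding T_def by metis+
        have d: "\<not> h v w" "\<not> h w u" "(col u = 0 \<and> col w = 1 \<and> col v = 2) \<or>
            (col w = 0 \<and> col v = 1 \<and> col u = 2) \<or> (col v = 0 \<and> col u = 1 \<and> col w = 2)"
          using cols[of u] vw wu by auto
        have V: "u \<in> V" "v \<in> V" "w \<in> V" using t unfolding T_def by auto
        have sym: "\<not> h v u" "\<not> h w v" "\<not> h u w" using d down h_sym by blast+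
        show False
          using no_empty[OF V(1,3,2)] no_empty[OF V(3,2,1)] no_empty[OF V(2,1,3)] d down(2) sym by metis
      qed
    qed
    show False if t: "T u v" "T v w" "T w z" "T z u" and c: "col u = col w" "col v = col z" for u v w z
    proof -
      have V: "u \<in> V" "v \<in> V" "w \<in> V" "z \<in> V" using t unfolding T_def by auto
      consider (up) "col v = (col u + 1) mod 3" | (down) "col u = (col v + 1) mod 3"
        using t(1) unfolding T_def by blast
      then have "h u v \<and> \<not> h v w \<and> h w z \<and> \<not> h z u \<or> \<not> h u v \<and> h v w \<and> \<not> h w z \<and> h z u"
      proof cases
        case up
        then have "col u \<noteq> (col v + 1) mod 3" using one_way by blast
        then show ?thesis using t c unfolding T_def by metis
      next
        case down
        then have "col v \<noteq> (col u + 1) mod 3" using one_way by blast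
        then show ?thesis using t c unfolding T_def by metis
      qed
      then consider (up) "h u v" "\<not> h v w" "h w z" "\<not> h z u" | (down) "\<not> h u v" "h v w" "\<not> h w z" "h z u"
        by blast
      then show False
      proof cases
        case up
        then show False using no_matching[of u v w z] V c h_sym by blast
      next
        case down
        then show False using no_matching[of v w z u] V c h_sym by metis
      qed
    qed
  qed
  then obtain R where R: "\<forall>u. \<not> R u u" "\<forall>u v w. R u v \<longrightarrow> R v w \<longrightarrow> R u w" "\<forall>u v. T u v \<longrightarrow> R u v"
    by blast
  have "col v < 3" for v using cols[of v] by auto
  moreover have "if h u v then R u v else R v u"
    if "u \<in> V" "v \<in> V" "col v = (col u + 1) mod 3" for u v
  proof -
    have "if h u v then T u v else T v u" using that h_sym unfolding T_def by metis
    then show ?thesis using R(3) by (auto split: if_splits)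
  qed
  ultimately show ?thesis
    using R same_col by (intro exI[of _ col] exI[of _ R]) simp
qed

end

section \<open>Countable orders in dense sets of reals\<close>

text \<open>The points are placed one after the other along an enumeration of \<open>V\<close>.  A new point has to
go above the placed points that precede it and below those that follow it; transitivity makes
this a non-empty interval, and \<open>D v\<close> has a point in it that avoids the finitely many used values.\<close>

lemma strict_order_embeds_in_dense_sets:
  fixes R :: "'a \<Rightarrow> 'a \<Rightarrow> bool" and D :: "'a \<Rightarrow> real set"
  assumes V: "countable V"
    and irrefl: "\<And>u. \<not> R u u" and trans: "\<And>u v w. R u v \<Longrightarrow> R v w \<Longrightarrow> R u w"
    and dense: "\<And>v a b. v \<in> V \<Longrightarrow> 0 \<le> a \<Longrightarrow> a < b \<Longrightarrow> b \<le> 1 \<Longrightarrow> \<exists>t\<in>D v. a < t \<and> t < b"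
  shows "\<exists>f. inj_on f V \<and> (\<forall>v\<in>V. f v \<in> D v \<and> 0 < f v \<and> f v < 1) \<and>
             (\<forall>u\<in>V. \<forall>v\<in>V. R u v \<longrightarrow> f u < f v)"
proof -
  define idx where "idx = to_nat_on V"
  have inj: "inj_on idx V" unfolding idx_def using V by (rule inj_on_to_nat_on)
  define P where "P f v t \<longleftrightarrow> (v \<in> V \<longrightarrow> t \<in> D v \<and> 0 < t \<and> t < 1 \<and>
      (\<forall>u\<in>V. idx u < idx v \<longrightarrow> f u \<noteq> t \<and> (R u v \<longrightarrow> f u < t) \<and> (R v u \<longrightarrow> t < f u)))"
    for f :: "'a \<Rightarrow> real" and v t
  have "\<exists>f. \<forall>v. P f v (f v)"
  proof (rule dependent_wf_choice[of "inv_image less_than idx"])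
    show "wf (inv_image less_than idx)" by (simp add: wf_inv_image)
    show "P f v t = P g v t" if "\<And>u. (u, v) \<in> inv_image less_than idx \<Longrightarrow> f u = g u" for f g v t
    proof -
      have "f u = g u" if "idx u < idx v" for u
        using \<open>\<And>u. (u, v) \<in> inv_image less_than idx \<Longrightarrow> f u = g u\<close> that by simp
      then show ?thesis by (auto simp: P_def)
    qed
  next
    fix v f
    assume IH: "\<And>u. (u, v) \<in> inv_image less_than idx \<Longrightarrow> P f u (f u)"
    have IH: "P f u (f u)" if "idx u < idx v" for u using IH that by simp
    show "\<exists>t. P f v t"
    proof (cases "v \<in> V")
      case True
      define A where "A = {u \<in> V. idx u < idx v}"
      have "finite (idx ` A)" by (rule finite_subset[of _ "{..<idx v}"]) (auto simp: A_def)
      then have finA: "finite A"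
        using finite_imageD inj_on_subset[OF inj] unfolding A_def by (metis (no_types, lifting) mem_Collect_eq subsetI)
      have mono: "f u < f w" if "u \<in> A" "w \<in> A" "R u w" for u w
      proof -
        have "idx u \<noteq> idx w" using inj that irrefl unfolding A_def inj_on_def by blast
        then show ?thesis
          using IH[of u] IH[of w] that unfolding A_def P_def by (auto simp: neq_iff)
      qed
      have between: "f a < f b" if "a \<in> A" "b \<in> A" "R a v" "R v b" for a b
        using mono that trans by blast
      have rng: "0 < f u" "f u < 1" if "u \<in> A" for u using IH[of u] that unfolding A_def P_def by auto
      \<comment> \<open>The constraints for the new value; 0 and 1 keep it inside the unit interval.\<close>
      define lo where "lo = Max (insert 0 (f ` {u \<in> A. R u v}))"
      define hi where "hi = Min (insert 1 (f ` {u \<in> A. R v u}))"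
      have fin: "finite (insert 0 (f ` {u \<in> A. R u v}))" "finite (insert 1 (f ` {u \<in> A. R v u}))"
        using finA by auto
      have "lo < hi"
        unfolding lo_def hi_def using fin between rng by (subst Max_less_iff; simp)
      moreover have "0 \<le> lo" "hi \<le> 1" unfolding lo_def hi_def using fin by auto
      \<comment> \<open>Below \<open>hi'\<close> no value above \<open>lo\<close> has been used.\<close>
      moreover define hi' where "hi' = Min (insert hi (f ` {u \<in> A. lo < f u}))"
      moreover have "lo < hi'" unfolding hi'_def using finA \<open>lo < hi\<close> by auto
      moreover have "hi' \<le> hi" unfolding hi'_def using finA by auto
      ultimately obtain t where t: "t \<in> D v" "lo < t" "t < hi'" "t < hi" "0 < t" "t < 1"
        using dense[OF True, of lo hi'] by fastforce
      have "f u \<noteq> t" if "u \<in> A" for u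
      proof
        assume "f u = t"
        then have "hi' \<le> f u" unfolding hi'_def using finA that t by (intro Min_le) auto
        then show False using t \<open>f u = t\<close> by simp
      qed
      moreover have "f u < t" if "u \<in> A" "R u v" for u
      proof -
        have "f u \<le> lo" unfolding lo_def using fin that by (intro Max_ge) auto
        then show ?thesis using t by simp
      qed
      moreover have "t < f u" if "u \<in> A" "R v u" for u
      proof -
        have "hi \<le> f u" unfolding hi_def using fin that by (intro Min_le) auto
        then show ?thesis using t by simp
      qed
      ultimately show ?thesis using t unfolding P_def A_def by blast
    qed (simp add: P_def)
  qed
  then obtain f where f: "\<And>v. P f v (f v)" by blast
  have "inj_on f V"
  proof (rule inj_onI, rule ccontr)
    fix u v assume uv: "u \<in> V" "v \<in> V" "f u = f v" "u \<noteq> v"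
    then have "idx u \<noteq> idx v" using inj unfolding inj_on_def by blast
    then show False using f[of u] f[of v] uv unfolding P_def by (metis neq_iff)
  qed
  moreover have "f u < f v" if "u \<in> V" "v \<in> V" "R u v" for u v
  proof -
    have "idx u \<noteq> idx v" using inj that irrefl unfolding inj_on_def by blast
    then show ?thesis using f[of u] f[of v] that unfolding P_def by (metis neq_iff)
  qed
  moreover have "\<forall>v\<in>V. f v \<in> D v \<and> 0 < f v \<and> f v < 1" using f unfolding P_def by blast
  ultimately show ?thesis by blast
qed

section \<open>Arcs of a circle\<close>

lemma circle_point_eq_iff:
  assumes "r > 0"
  shows "circle_point c r s = circle_point c r t \<longleftrightarrow> (\<exists>k::int. s = t + of_int k * (2 * pi * r))"
proof -
  have "circle_point c r s = circle_point c r t \<longleftrightarrow> sin (s / r) = sin (t / r) \<and> cos (s / r) = cos (t / r)"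
    using assms by (auto simp: circle_point_def complex_eq_iff)
  also have "\<dots> \<longleftrightarrow> (\<exists>k::int. s / r = t / r + 2 * pi * k)" by (rule sin_cos_eq_iff)
  also have "\<dots> \<longleftrightarrow> (\<exists>k::int. s = t + of_int k * (2 * pi * r))"
    using assms by (simp add: field_simps)
  finally show ?thesis .
qed

lemma int_multiple_small:
  fixes k :: int and L :: real
  assumes "\<bar>of_int k * L\<bar> < L" shows "k = 0"
proof (rule ccontr)
  assume "k \<noteq> 0"
  then have "1 \<le> \<bar>of_int k :: real\<bar>" by linarith
  moreover have "0 < L" using assms by linarith
  ultimately have "1 * L \<le> \<bar>of_int k\<bar> * L" by (intro mult_right_mono) auto
  then show False using assms \<open>0 < L\<close> by (simp add: abs_mult)
qed

lemma circle_point_mem_image: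
  assumes "r > 0"
  shows "circle_point c r x \<in> circle_point c r ` I \<longleftrightarrow> (\<exists>k::int. x + of_int k * (2 * pi * r) \<in> I)"
proof
  assume "circle_point c r x \<in> circle_point c r ` I"
  then obtain y where "y \<in> I" "circle_point c r y = circle_point c r x" by auto
  then show "\<exists>k::int. x + of_int k * (2 * pi * r) \<in> I"
    unfolding circle_point_eq_iff[OF assms] by blast
next
  assume "\<exists>k::int. x + of_int k * (2 * pi * r) \<in> I"
  then obtain k :: int where "x + of_int k * (2 * pi * r) \<in> I" by blast
  moreover have "circle_point c r (x + of_int k * (2 * pi * r)) = circle_point c r x"
    unfolding circle_point_eq_iff[OF assms] by blast
  ultimately show "circle_point c r x \<in> circle_point c r ` I" by (metis imageI)
qed

text \<open>The image of a compact interval is closed, whereas an open arc shorter than the circle misses the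
limit \<open>s\<close> of its own points.\<close>

lemma closed_arc_neq_open_arc:
  assumes r: "r > 0" and l: "0 < l" "l < 2 * pi * r"
  shows "closed_arc c r s' l' \<noteq> open_arc c r s l"
proof
  assume eq: "closed_arc c r s' l' = open_arc c r s l"
  have cont: "continuous_on UNIV (circle_point c r)"
    unfolding circle_point_def using r by (intro continuous_intros) auto
  have "compact (closed_arc c r s' l')"
    unfolding closed_arc_def by (intro compact_continuous_image continuous_on_subset[OF cont]) auto
  then have "closed (open_arc c r s l)" using eq compact_imp_closed by metis
  moreover have "circle_point c r (s + l / real (n + 2)) \<in> open_arc c r s l" for n
    unfolding open_arc_def using l mult_nonneg_nonneg[of l "real n"]
    by (intro imageI) (simp add: field_simps add_pos_nonneg)
  moreover have "(\<lambda>n. circle_point c r (s + l / real (n + 2))) \<longlonglongrightarrow> circle_point c r s"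
  proof (rule continuous_on_tendsto_compose[OF cont])
    show "(\<lambda>n. s + l / real (n + 2)) \<longlonglongrightarrow> s"
      using tendsto_add[OF tendsto_const LIMSEQ_ignore_initial_segment[OF lim_const_over_n[of l], of 2]] by simp
  qed auto
  ultimately have "circle_point c r s \<in> open_arc c r s l"
    using closed_sequentially[where f = "\<lambda>n. circle_point c r (s + l / real (n + 2))"] by blast
  then obtain k :: int where "0 < of_int k * (2 * pi * r)" "of_int k * (2 * pi * r) < l"
    unfolding open_arc_def circle_point_mem_image[OF r] by auto
  then have "\<bar>of_int k * (2 * pi * r)\<bar> < 2 * pi * r" using l by linarith
  then have "k = 0" by (rule int_multiple_small)
  then show False using \<open>0 < of_int k * (2 * pi * r)\<close> by simp
qed

text \<open>Just before its first point and just after its last point an arc shorter than the circle is left.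
If the first point \<open>s'\<close> of one description were not the first point of the other, points slightly
before \<open>s'\<close> would still belong to the arc.\<close>

lemma closed_arc_end_points_unique:
  assumes r: "r > 0" and l: "0 < l" and l': "0 < l'" "l' < 2 * pi * r"
    and eq: "closed_arc c r s l = closed_arc c r s' l'"
  shows "circle_point c r s' = circle_point c r s" "circle_point c r (s' + l') = circle_point c r (s + l)"
proof -
  define L where "L = 2 * pi * r"
  note mem = circle_point_mem_image[OF r, of c _ "{t..t + d}" for t d, folded closed_arc_def L_def]
  have no: "\<not> (0 < of_int k * L \<and> of_int k * L < L)" for k :: int
    using int_multiple_small[of k L] by auto
  have "circle_point c r s' \<in> closed_arc c r s l" "circle_point c r (s' + l') \<in> closed_arc c r s l"
    unfolding eq mem using l' by (auto intro!: exI[of _ 0])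
  then obtain k m :: int where k: "s \<le> s' + of_int k * L" "s' + of_int k * L \<le> s + l"
    and m: "s \<le> s' + l' + of_int m * L" "s' + l' + of_int m * L \<le> s + l"
    unfolding mem by auto
  have "s' + of_int k * L = s"
  proof (rule ccontr)
    assume "s' + of_int k * L \<noteq> s"
    then obtain e where e: "0 < e" "e < s' + of_int k * L - s" "e < L - l'"
      using dense[of 0 "min (s' + of_int k * L - s) (L - l')"] k l' unfolding L_def by auto
    then have "circle_point c r (s' + of_int k * L - e) \<in> closed_arc c r s' l'"
      unfolding eq[symmetric] mem using k by (intro exI[of _ 0]) auto
    then obtain j :: int where "s' \<le> s' + of_int k * L - e + of_int j * L"
        "s' + of_int k * L - e + of_int j * L \<le> s' + l'"
      unfolding mem by auto
    then show False using no[of "k + j"] e by (simp add: algebra_simps)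
  qed
  then show "circle_point c r s' = circle_point c r s"
    unfolding circle_point_eq_iff[OF r] L_def by (intro exI[of _ "- k"]) simp
  have "s' + l' + of_int m * L = s + l"
  proof (rule ccontr)
    assume "s' + l' + of_int m * L \<noteq> s + l"
    then obtain e where e: "0 < e" "e < s + l - (s' + l' + of_int m * L)" "e < L - l'"
      using dense[of 0 "min (s + l - (s' + l' + of_int m * L)) (L - l')"] m l' unfolding L_def by auto
    then have "circle_point c r (s' + l' + of_int m * L + e) \<in> closed_arc c r s' l'"
      unfolding eq[symmetric] mem using m by (intro exI[of _ 0]) auto
    then obtain j :: int where "s' \<le> s' + l' + of_int m * L + e + of_int j * L"
        "s' + l' + of_int m * L + e + of_int j * L \<le> s' + l'"
      unfolding mem by auto
    then show False using no[of "- (m + j)"] e by (simp add: algebra_simps)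
  qed
  then show "circle_point c r (s' + l') = circle_point c r (s + l)"
    unfolding circle_point_eq_iff[OF r] L_def by (intro exI[of _ "- m"]) simp
qed

lemma arc_end_points_closed_arc:
  assumes r: "r > 0" and l: "0 < l" "l < 2 * pi * r"
  shows "arc_end_points c r (closed_arc c r s l) = {circle_point c r s, circle_point c r (s + l)}"
proof -
  have "circle_point c r s' = circle_point c r s \<and> circle_point c r (s' + l') = circle_point c r (s + l)"
    if "0 < l'" "l' < 2 * pi * r"
      "closed_arc c r s l = closed_arc c r s' l' \<or> closed_arc c r s l = open_arc c r s' l'" for s' l'
    using closed_arc_end_points_unique[OF r l(1)] closed_arc_neq_open_arc[OF r] that by blast
  then have "arc_end_points c r (closed_arc c r s l) \<subseteq> {circle_point c r s, circle_point c r (s + l)}"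
    unfolding arc_end_points_def by blast
  then show ?thesis using l unfolding arc_end_points_def by blast
qed

text \<open>Lifts of unit arcs to the line.  The flag selects closed or open intervals, so that models by
closed arcs and models by open arcs are treated together.\<close>

definition unit_interval :: "bool \<Rightarrow> real \<Rightarrow> real set" where
  "unit_interval cl s = (if cl then {s..s + 1} else {s<..<s + 1})"

definition unit_arc :: "complex \<Rightarrow> real \<Rightarrow> bool \<Rightarrow> real \<Rightarrow> complex set" where
  "unit_arc c r cl s = circle_point c r ` unit_interval cl s"

lemma unit_arc_eq: "unit_arc c r True s = closed_arc c r s 1" "unit_arc c r False s = open_arc c r s 1"
  unfolding unit_arc_def unit_interval_def closed_arc_def open_arc_def by simp_all

lemma unit_intervals_meet:
  "unit_interval cl s \<inter> unit_interval cl t \<noteq> {} \<longleftrightarrow> (if cl then \<bar>s - t\<bar> \<le> 1 else \<bar>s - t\<bar> < 1)"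
proof -
  have "\<bar>s - t\<bar> \<le> 1 \<Longrightarrow> max s t \<in> {s..s + 1} \<inter> {t..t + 1}" by auto
  moreover have "\<bar>s - t\<bar> < 1 \<Longrightarrow> (s + t + 1) / 2 \<in> {s<..<s + 1} \<inter> {t<..<t + 1}" by (auto simp: abs_less_iff field_simps)
  moreover have "x \<in> {s..s + 1} \<inter> {t..t + 1} \<Longrightarrow> \<bar>s - t\<bar> \<le> 1" for x by auto
  moreover have "x \<in> {s<..<s + 1} \<inter> {t<..<t + 1} \<Longrightarrow> \<bar>s - t\<bar> < 1" for x by auto
  ultimately show ?thesis unfolding unit_interval_def by (smt (verit) all_not_in_conv)
qed

lemma unit_interval_shift: "x + d \<in> unit_interval cl s \<longleftrightarrow> x \<in> unit_interval cl (s - d)"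
  unfolding unit_interval_def by auto

lemma circle_point_mem_unit_arc:
  assumes "r > 0"
  shows "circle_point c r x \<in> unit_arc c r cl s \<longleftrightarrow>
    (\<exists>k::int. x \<in> unit_interval cl (s + of_int k * (2 * pi * r)))"
proof -
  have "circle_point c r x \<in> unit_arc c r cl s \<longleftrightarrow> (\<exists>k::int. x + of_int k * (2 * pi * r) \<in> unit_interval cl s)"
    unfolding unit_arc_def by (rule circle_point_mem_image[OF assms])
  also have "\<dots> \<longleftrightarrow> (\<exists>k::int. x \<in> unit_interval cl (s - of_int k * (2 * pi * r)))"
    by (simp add: unit_interval_shift)
  also have "\<dots> \<longleftrightarrow> (\<exists>k::int. x \<in> unit_interval cl (s + of_int k * (2 * pi * r)))"
    by (metis (no_types, opaque_lifting) add_uminus_conv_diff minus_minus mult_minus_left of_int_minus)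
  finally show ?thesis .
qed

lemma unit_arc_shift:
  assumes "r > 0" shows "unit_arc c r cl (s + of_int k * (2 * pi * r)) = unit_arc c r cl s"
proof -
  have sub: "unit_arc c r cl t \<subseteq> unit_arc c r cl (t + of_int k * (2 * pi * r))" for t and k :: int
  proof
    fix z assume "z \<in> unit_arc c r cl t"
    then obtain x where x: "z = circle_point c r x" "x \<in> unit_interval cl t" unfolding unit_arc_def by auto
    then have "x \<in> unit_interval cl (t + of_int k * (2 * pi * r) + of_int (- k) * (2 * pi * r))" by simp
    then show "z \<in> unit_arc c r cl (t + of_int k * (2 * pi * r))"
      unfolding x(1) circle_point_mem_unit_arc[OF assms] by blast
  qed
  show ?thesis
    using sub[of s k] sub[of "s + of_int k * (2 * pi * r)" "- k"] by (simp add: algebra_simps)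
qed

lemma unit_arcs_meet:
  assumes "r > 0"
  shows "unit_arc c r cl s \<inter> unit_arc c r cl t \<noteq> {} \<longleftrightarrow>
    (\<exists>k::int. unit_interval cl s \<inter> unit_interval cl (t + of_int k * (2 * pi * r)) \<noteq> {})" (is "?L \<longleftrightarrow> ?R")
proof
  assume ?L
  then obtain x where "x \<in> unit_interval cl s" "circle_point c r x \<in> unit_arc c r cl t"
    unfolding unit_arc_def[of c r cl s] by blast
  then show ?R unfolding circle_point_mem_unit_arc[OF assms] by blast
next
  assume ?R
  then obtain k :: int and x where "x \<in> unit_interval cl s" "x \<in> unit_interval cl (t + of_int k * (2 * pi * r))" by blast
  then have "circle_point c r x \<in> unit_arc c r cl s" "circle_point c r x \<in> unit_arc c r cl t"
    by (simp add: unit_arc_def, unfold circle_point_mem_unit_arc[OF assms], blast)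
  then show ?L by blast
qed

lemma closed_unit_arcs_meet:
  assumes "r > 0"
  shows "closed_arc c r s 1 \<inter> closed_arc c r t 1 \<noteq> {} \<longleftrightarrow>
    (\<exists>k::int. \<bar>s - t - of_int k * (2 * pi * r)\<bar> \<le> 1)"
  using unit_arcs_meet[OF assms, of c True s t] unfolding unit_intervals_meet unit_arc_eq
  by (simp add: algebra_simps)

section \<open>Induced subgraphs\<close>

lemma induced_subgraph_iff:
  "isomorphic_to_induced_subgraph F G \<longleftrightarrow>
    (\<exists>f. inj_on f (verts F) \<and> f ` verts F \<subseteq> verts G \<and>
         (\<forall>x\<in>verts F. \<forall>y\<in>verts F. adj F x y \<longleftrightarrow> adj G (f x) (f y)))" (is "?L \<longleftrightarrow> ?R")
proof
  assume ?L
  then obtain W f where W: "W \<subseteq> verts G" and f: "bij_betw f (verts F) W"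
    and a: "\<forall>x\<in>verts F. \<forall>y\<in>verts F. adj F x y \<longleftrightarrow> f x \<in> W \<and> f y \<in> W \<and> adj G (f x) (f y)"
    unfolding isomorphic_to_induced_subgraph_def graph_isomorphic_def induced_subgraph_def by auto
  have "f x \<in> W" if "x \<in> verts F" for x using f that by (rule bij_betwE[rule_format])
  then show ?R using W f a unfolding bij_betw_def by (intro exI[of _ f]) simp
next
  assume ?R
  then obtain f where "inj_on f (verts F)" "f ` verts F \<subseteq> verts G"
    "\<forall>x\<in>verts F. \<forall>y\<in>verts F. adj F x y \<longleftrightarrow> adj G (f x) (f y)" by blast
  then have "graph_isomorphic F (induced_subgraph G (f ` verts F))"
    unfolding graph_isomorphic_def induced_subgraph_def bij_betw_def by (intro exI[of _ f]) simp
  then show ?L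
    unfolding isomorphic_to_induced_subgraph_def using \<open>f ` verts F \<subseteq> verts G\<close> by blast
qed

lemma induced_subgraph_of_list:
  assumes "verts F = {..<n}" "length xs = n" "distinct xs" "set xs \<subseteq> verts G"
    and "\<forall>i<n. \<forall>j<n. adj F i j \<longleftrightarrow> adj G (xs ! i) (xs ! j)"
  shows "isomorphic_to_induced_subgraph F G"
proof -
  have "inj_on ((!) xs) {..<n}" using assms(2,3) by (intro inj_on_nth) auto
  moreover have "(!) xs ` {..<n} \<subseteq> verts G" using assms(2,4) nth_mem by blast
  ultimately show ?thesis
    unfolding induced_subgraph_iff assms(1) using assms(5) by blast
qed

lemma induced_subgraph_arcs:
  assumes "isomorphic_to_induced_subgraph F G" "graph_isomorphic G (intersection_graph \<A>)"
  obtains a where "inj_on a (verts F)" "a ` verts F \<subseteq> \<A>"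
    "\<And>x y. x \<in> verts F \<Longrightarrow> y \<in> verts F \<Longrightarrow> x \<noteq> y \<Longrightarrow> adj F x y \<longleftrightarrow> a x \<inter> a y \<noteq> {}"
proof -
  obtain f where f: "inj_on f (verts F)" "f ` verts F \<subseteq> verts G"
    "\<And>x y. x \<in> verts F \<Longrightarrow> y \<in> verts F \<Longrightarrow> adj F x y \<longleftrightarrow> adj G (f x) (f y)"
    using assms(1) unfolding induced_subgraph_iff by blast
  obtain g where g: "inj_on g (verts G)" "g ` verts G = \<A>"
    "\<And>x y. x \<in> verts G \<Longrightarrow> y \<in> verts G \<Longrightarrow> adj G x y \<longleftrightarrow> g x \<noteq> g y \<and> g x \<inter> g y \<noteq> {}"
    using assms(2) unfolding graph_isomorphic_def intersection_graph_def bij_betw_def by auto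
  have inj: "inj_on (g \<circ> f) (verts F)" using f g by (metis comp_inj_on inj_on_subset)
  show ?thesis
  proof (rule that[of "g \<circ> f"])
    show "inj_on (g \<circ> f) (verts F)" by (rule inj)
    show "(g \<circ> f) ` verts F \<subseteq> \<A>" using f g by auto
    show "adj F x y \<longleftrightarrow> (g \<circ> f) x \<inter> (g \<circ> f) y \<noteq> {}"
      if xy: "x \<in> verts F" "y \<in> verts F" "x \<noteq> y" for x y
    proof -
      have "g (f x) \<noteq> g (f y)" using inj xy unfolding inj_on_def by auto
      then show ?thesis using f(2) f(3)[OF xy(1,2)] g(3)[of "f x" "f y"] xy by auto
    qed
  qed
qed

lemma all_less_numerals:
  fixes P :: "nat \<Rightarrow> bool"
  shows "(\<forall>i<3. P i) \<longleftrightarrow> P 0 \<and> P 1 \<and> P 2"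
    "(\<forall>i<5. P i) \<longleftrightarrow> P 0 \<and> P 1 \<and> P 2 \<and> P 3 \<and> P 4"
    "(\<forall>i<6. P i) \<longleftrightarrow> P 0 \<and> P 1 \<and> P 2 \<and> P 3 \<and> P 4 \<and> P 5"
  by (simp_all add: numeral_eq_Suc All_less_Suc conj_ac)

text \<open>The vertices are listed along the rim: in a 4-wheel opposite rim vertices form the two edges of
the complement, and in a 5-wheel the cycle of the complement is the pentagram of the rim.\<close>

lemma obstruction_free_complement:
  assumes G: "countable_simple_graph G"
    and free: "graph_free {edgeless_graph 3, wheel_graph 4, wheel_graph 5,
                           graph_complement (cycle_graph 6)} G"
  shows "obstruction_free_graph (verts G) (adj (graph_complement G))"
proof -
  define h where "h = adj (graph_complement G)"
  have h: "h x y \<longleftrightarrow> x \<in> verts G \<and> y \<in> verts G \<and> x \<noteq> y \<and> \<not> adj G x y" for x y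
    unfolding h_def graph_complement_def by simp
  have A: "adj G x y \<longleftrightarrow> x \<in> verts G \<and> y \<in> verts G \<and> x \<noteq> y \<and> \<not> h x y" for x y
    using G unfolding h countable_simple_graph_def by blast
  have sym: "h x y \<Longrightarrow> h y x" for x y using G unfolding h countable_simple_graph_def by blast
  then have not_sym: "\<not> h x y \<Longrightarrow> \<not> h y x" for x y by blast
  have V: "h x y \<Longrightarrow> x \<in> verts G" "h x y \<Longrightarrow> y \<in> verts G" "\<not> h x x" for x y unfolding h by auto
  have "obstruction_free_graph (verts G) h"
  proof
    show "h x y \<Longrightarrow> x \<in> verts G" for x y by (rule V)
    show "h x y \<Longrightarrow> h y x" for x y using sym by blast
    show "\<not> h x x" for x by (rule V)
    show no3: False if e: "h x y" "h y z" "h x z" for x y z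
    proof -
      have d: "distinct [x, y, z]" using e V(3) by auto
      have m: "set [x, y, z] \<subseteq> verts G" using e V(1,2) by simp
      have "isomorphic_to_induced_subgraph (edgeless_graph 3) G"
        by (rule induced_subgraph_of_list[OF _ _ d m, where n = 3])
          (use e e[THEN sym] in \<open>simp_all add: edgeless_graph_def A all_less_numerals\<close>)
      then show False using free unfolding graph_free_def by blast
    qed
    show False
      if e: "h a b" "h c d" and n: "\<not> h a c" "\<not> h a d" "\<not> h b c" "\<not> h b d"
        and x: "x \<in> verts G" and nx: "\<not> h x a" "\<not> h x b" "\<not> h x c" "\<not> h x d" for a b c d x
    proof -
      have d: "distinct [a, c, b, d, x]" using e e[THEN sym] n nx V(3) by auto
      have m: "set [a, c, b, d, x] \<subseteq> verts G" using e x V(1,2) by simp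
      have "isomorphic_to_induced_subgraph (wheel_graph 4) G"
        by (rule induced_subgraph_of_list[OF _ _ d m, where n = 5])
          (use d m e n nx e[THEN sym] n[THEN not_sym] nx[THEN not_sym] in
            \<open>auto simp: wheel_graph_def cycle_graph_def A all_less_numerals\<close>)
      then show False using free unfolding graph_free_def by blast
    qed
    show False
      if e: "h a b" "h b c" "h c d" "h d e" "h e a"
        and x: "x \<in> verts G" and nx: "\<not> h x a" "\<not> h x b" "\<not> h x c" "\<not> h x d" "\<not> h x e" for a b c d e x
    proof -
      have n: "\<not> h a c" "\<not> h a d" "\<not> h b d" "\<not> h b e" "\<not> h c e" using no3 e sym by meson+
      have d: "distinct [a, c, e, b, d, x]" using e e[THEN sym] n nx V(3) by auto
      have m: "set [a, c, e, b, d, x] \<subseteq> verts G" using e x V(1,2) by simp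
      have "isomorphic_to_induced_subgraph (wheel_graph 5) G"
        by (rule induced_subgraph_of_list[OF _ _ d m, where n = 6])
          (use d m e n nx e[THEN sym] n[THEN not_sym] nx[THEN not_sym] in
            \<open>auto simp: wheel_graph_def cycle_graph_def A all_less_numerals\<close>)
      then show False using free unfolding graph_free_def by blast
    qed
    show False
      if e: "h a b" "h b c" "h c d" "h d e" "h e f" "h f a"
        and n: "\<not> h a d" "\<not> h b e" "\<not> h c f" for a b c d e f
    proof -
      have n': "\<not> h a c" "\<not> h a e" "\<not> h b d" "\<not> h b f" "\<not> h c e" "\<not> h d f" using no3 e sym by meson+
      have d: "distinct [a, b, c, d, e, f]" using e e[THEN sym] n n' V(3) by auto
      have m: "set [a, b, c, d, e, f] \<subseteq> verts G" using e V(1,2) by simp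
      have "isomorphic_to_induced_subgraph (graph_complement (cycle_graph 6)) G"
        by (rule induced_subgraph_of_list[OF _ _ d m, where n = 6])
          (use d m e n n' e[THEN sym] n[THEN not_sym] n'[THEN not_sym] in
            \<open>auto simp: graph_complement_def cycle_graph_def A all_less_numerals\<close>)
      then show False using free unfolding graph_free_def by blast
    qed
  qed
  then show ?thesis unfolding h_def .
qed

section \<open>Embedding into the generic circular triangle-free graph\<close>

text \<open>Points of the unit circle are given by a coordinate with period 3, so that a third of a turn is a
unit step.\<close>

lemma cis_third_eq_iff:
  "cis (2 * pi * p / 3) = cis (2 * pi * q / 3) \<longleftrightarrow> (\<exists>k::int. p = q + 3 * of_int k)"
proof -
  have "cis (2 * pi * p / 3) = cis (2 * pi * q / 3) \<longleftrightarrow>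
      sin (2 * pi * p / 3) = sin (2 * pi * q / 3) \<and> cos (2 * pi * p / 3) = cos (2 * pi * q / 3)"
    by (auto simp: complex_eq_iff)
  also have "\<dots> \<longleftrightarrow> (\<exists>k::int. 2 * pi * p / 3 = 2 * pi * q / 3 + 2 * pi * k)"
    by (rule sin_cos_eq_iff)
  also have "\<dots> \<longleftrightarrow> (\<exists>k::int. p = q + 3 * of_int k)"
  proof -
    have "2 * pi * p / 3 = 2 * pi * q / 3 + 2 * pi * of_int k \<longleftrightarrow> p = q + 3 * of_int k" for k :: int
    proof -
      have "2 * pi * q / 3 + 2 * pi * of_int k = 2 * pi * (q + 3 * of_int k) / 3" by (simp add: field_simps)
      then show ?thesis by simp
    qed
    then show ?thesis by simp
  qed
  finally show ?thesis .
qed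

lemma unit_circle_third:
  assumes "norm z = 1"
  obtains p where "a \<le> p" "p < a + 3" "z = cis (2 * pi * p / 3)"
proof -
  have "z \<noteq> 0" using assms by auto
  define t where "t = 3 * Arg z / (2 * pi)"
  have z: "z = cis (2 * pi * t / 3)"
    unfolding t_def using assms \<open>z \<noteq> 0\<close> by (simp add: cis_Arg sgn_div_norm)
  define k where "k = \<lfloor>(t - a) / 3\<rfloor>"
  have "of_int k \<le> (t - a) / 3" "(t - a) / 3 < of_int k + 1" unfolding k_def by linarith+
  moreover have "z = cis (2 * pi * (t - 3 * of_int k) / 3)"
    unfolding z cis_third_eq_iff by (intro exI[of _ k]) simp
  ultimately show ?thesis by (intro that[of "t - 3 * of_int k"]) auto
qed

lemma generic_adj_iff:
  "adj (generic_circular_triangle_free_graph S) (cis (2 * pi * p / 3)) (cis (2 * pi * q / 3)) \<longleftrightarrow>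
     cis (2 * pi * p / 3) \<in> S \<and> cis (2 * pi * q / 3) \<in> S \<and> (\<forall>k::int. \<bar>p - q - 3 * of_int k\<bar> > 1)"
    (is "adj _ ?x ?y \<longleftrightarrow> _")
proof -
  have "?x \<noteq> ?y \<and> (\<forall>s l. 0 < l \<and> l < 2 * pi \<and> {cis s, cis (s + l)} = {?x, ?y} \<longrightarrow> l > 2 * pi / 3) \<longleftrightarrow>
      (\<forall>k::int. \<bar>p - q - 3 * of_int k\<bar> > 1)" (is "?arcs \<longleftrightarrow> ?far")
  proof
    assume far: ?far
    have "?x \<noteq> ?y"
    proof
      assume "?x = ?y"
      then obtain k :: int where "p = q + 3 * of_int k" unfolding cis_third_eq_iff by blast
      then show False using far[rule_format, of k] by simp
    qed
    moreover have "l > 2 * pi / 3"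
      if l: "0 < l" "l < 2 * pi" and xy: "{cis s, cis (s + l)} = {?x, ?y}" for s l
    proof -
      define a b where "a = 3 * s / (2 * pi)" and "b = 3 * l / (2 * pi)"
      have s: "s = 2 * pi * a / 3" "s + l = 2 * pi * (a + b) / 3" "l = 2 * pi / 3 * b"
        unfolding a_def b_def by (simp_all add: field_simps)
      have "b > 0" unfolding b_def using l by simp
      consider "cis s = ?x" "cis (s + l) = ?y" | "cis s = ?y" "cis (s + l) = ?x"
        using xy unfolding doubleton_eq_iff by blast
      then have "b > 1"
      proof cases
        case 1
        then obtain k m :: int where "a = p + 3 * of_int k" "a + b = q + 3 * of_int m"
          using cis_third_eq_iff[of a p] cis_third_eq_iff[of "a + b" q] unfolding s(1,2)[symmetric] by blast
        then have "p - q - 3 * of_int (m - k) = - b" by simp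
        then show "b > 1" using far[rule_format, of "m - k"] \<open>b > 0\<close> by simp
      next
        case 2
        then obtain k m :: int where "a = q + 3 * of_int k" "a + b = p + 3 * of_int m"
          using cis_third_eq_iff[of a q] cis_third_eq_iff[of "a + b" p] unfolding s(1,2)[symmetric] by blast
        then have "p - q - 3 * of_int (k - m) = b" by simp
        then show "b > 1" using far[rule_format, of "k - m"] \<open>b > 0\<close> by simp
      qed
      then show ?thesis unfolding s(3) by simp
    qed
    ultimately show ?arcs by blast
  next
    assume arcs: ?arcs
    show ?far
    proof
      fix k :: int
      define d where "d = p - q - 3 * of_int k"
      have "d \<noteq> 0"
      proof
        assume "d = 0"
        then have "p = q + 3 * of_int k" unfolding d_def by simp
        then show False using arcs unfolding cis_third_eq_iff by blast
      qed
      have x: "?x = cis (2 * pi * (q + d) / 3)" unfolding cis_third_eq_iff d_def by (intro exI[of _ k]) simp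
      have y: "?y = cis (2 * pi * q / 3)" ..
      have "\<bar>d\<bar> > 1"
      proof (rule ccontr)
        assume small: "\<not> \<bar>d\<bar> > 1"
        define s where "s = 2 * pi * (if d > 0 then q else q + d) / 3"
        define l where "l = 2 * pi * \<bar>d\<bar> / 3"
        have "{cis s, cis (s + l)} = {?x, ?y}"
          unfolding x s_def l_def using \<open>d \<noteq> 0\<close>
          by (auto simp: add_divide_distrib[symmetric] distrib_left[symmetric])
        moreover have "0 < l" unfolding l_def using \<open>d \<noteq> 0\<close> by simp
        moreover have le: "l \<le> 2 * pi / 3" unfolding l_def using small by (simp add: field_simps)
        moreover have "l < 2 * pi" using le pi_gt_zero by linarith
        ultimately have "2 * pi / 3 < l" using arcs[THEN conjunct2, rule_format, of l s] by blast
        then show False using le by simp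
      qed
      then show "\<bar>p - q - 3 * of_int k\<bar> > 1" unfolding d_def .
    qed
  qed
  then show ?thesis unfolding generic_circular_triangle_free_graph_def by auto
qed

text \<open>The points of the circle with no coordinate strictly between \<open>a\<close> and \<open>b\<close> form a compact set, whose
complement is a neighbourhood of the midpoint and therefore meets \<open>S\<close>.\<close>

lemma generic_circle_set_dense_in_thirds:
  assumes S: "generic_circle_set S" and ab: "a < b" "b \<le> a + 3"
  shows "\<exists>p. cis (2 * pi * p / 3) \<in> S \<and> a < p \<and> p < b"
proof -
  define K where "K = (\<lambda>p. cis (2 * pi * p / 3)) ` {b..a + 3}"
  define m where "m = (a + b) / 2"
  have "compact K"
    unfolding K_def by (intro compact_continuous_image continuous_intros) auto
  then have "open (- K)" by (simp add: compact_imp_closed open_Compl)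
  moreover have "cis (2 * pi * m / 3) \<in> - K"
  proof
    assume "cis (2 * pi * m / 3) \<in> K"
    then obtain p and k :: int where p: "b \<le> p" "p \<le> a + 3" and k: "m = p + 3 * of_int k"
      unfolding K_def image_iff cis_third_eq_iff by auto
    have "3 * of_int k < (0::real)" "- 3 < 3 * (of_int k :: real)" using p k ab unfolding m_def by (auto simp: field_simps)
    then have "k < 0" "- 1 < k" by linarith+
    then show False by simp
  qed
  moreover have "cis (2 * pi * m / 3) \<in> closure S"
    using S unfolding generic_circle_set_def by auto
  ultimately have "S \<inter> - K \<noteq> {}" using open_Int_closure_eq_empty[of "- K" S] by blast
  then obtain z where z: "z \<in> S" "z \<notin> K" by blast
  have "norm z = 1" using S z unfolding generic_circle_set_def by auto
  then obtain p where p: "a \<le> p" "p < a + 3" "z = cis (2 * pi * p / 3)" by (rule unit_circle_third)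
  have "p < b" using z(2) p unfolding K_def by force
  moreover have "p \<noteq> a"
  proof
    assume "p = a"
    then have "z = cis (2 * pi * (a + 3) / 3)" unfolding p(3) cis_third_eq_iff by (intro exI[of _ "- 1"]) simp
    then show False using z(2) ab unfolding K_def by auto
  qed
  ultimately show ?thesis using p z by auto
qed

text \<open>If a point is one third after another one and their positions within the thirds differ by \<open>d\<close>, then
\<open>d - 1\<close> is the difference of their coordinates.\<close>

lemma far_from_shift_iff:
  fixes d :: real assumes "d \<noteq> 0" "\<bar>d\<bar> < 1"
  shows "(\<forall>k::int. \<bar>d - 1 - 3 * of_int k\<bar> > 1) \<longleftrightarrow> d < 0"
proof
  assume "\<forall>k::int. \<bar>d - 1 - 3 * of_int k\<bar> > 1"
  then have "\<bar>d - 1 - 3 * of_int 0\<bar> > 1" by blast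
  then show "d < 0" using assms by (auto simp: abs_if split: if_splits)
next
  assume "d < 0"
  show "\<forall>k::int. \<bar>d - 1 - 3 * of_int k\<bar> > 1"
  proof
    fix k :: int
    consider "k = 0" | "k \<ge> 1" | "k \<le> - 1" by linarith
    then show "\<bar>d - 1 - 3 * of_int k\<bar> > 1"
    proof cases
      case 2
      then have "(of_int k :: real) \<ge> 1" by simp
      then show ?thesis using \<open>d < 0\<close> by linarith
    next
      case 3
      then have "(of_int k :: real) \<le> - 1" by linarith
      then show ?thesis using assms by linarith
    qed (use \<open>d < 0\<close> in simp)
  qed
qed

text \<open>A vertex in third \<open>col v\<close> at position \<open>f v\<close> is sent to the point with coordinate \<open>f v + col v\<close>.  The
positions are chosen in the order of \<open>R\<close>, inside the dense set of those that hit \<open>S\<close> in that third.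
Since they are distinct, no two points differ by exactly one third of a turn.\<close>

lemma obstruction_free_imp_generic:
  assumes G: "countable_simple_graph G" and S: "generic_circle_set S"
    and free: "graph_free {edgeless_graph 3, wheel_graph 4, wheel_graph 5,
                           graph_complement (cycle_graph 6)} G"
  shows "isomorphic_to_induced_subgraph (graph_complement G) (generic_circular_triangle_free_graph S)"
proof -
  define h where "h = adj (graph_complement G)"
  interpret obstruction_free_graph "verts G" h
    unfolding h_def by (rule obstruction_free_complement[OF G free])
  obtain o\<^sub>0 where o: "o\<^sub>0 \<in> verts G" using G unfolding countable_simple_graph_def by blast
  obtain col :: "'a \<Rightarrow> nat" and R where cr: "\<forall>v. col v < 3" "\<forall>u. \<not> R u u"
      "\<forall>u v w. R u v \<longrightarrow> R v w \<longrightarrow> R u w"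
      "\<forall>u\<in>verts G. \<forall>v\<in>verts G. (col u = col v \<longrightarrow> \<not> h u v) \<and>
         (col v = (col u + 1) mod 3 \<longrightarrow> (if h u v then R u v else R v u))"
    using ex_colour_order[OF o] by (elim exE conjE) (rule that; assumption)
  note col = cr(1)[rule_format] and R = cr(2,3)[rule_format]
  have same: "\<not> h u v" if "u \<in> verts G" "v \<in> verts G" "col u = col v" for u v
    using cr(4) that by blast
  have succ: "if h u v then R u v else R v u"
    if "u \<in> verts G" "v \<in> verts G" "col v = (col u + 1) mod 3" for u v
    using cr(4) that by blast
  have "\<exists>f. inj_on f (verts G) \<and>
      (\<forall>v\<in>verts G. f v \<in> {t. cis (2 * pi * (t + real (col v)) / 3) \<in> S} \<and> 0 < f v \<and> f v < 1) \<and>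
      (\<forall>u\<in>verts G. \<forall>v\<in>verts G. R u v \<longrightarrow> f u < f v)"
  proof (rule strict_order_embeds_in_dense_sets)
    show "countable (verts G)" using G unfolding countable_simple_graph_def by blast
    show "\<exists>t\<in>{t. cis (2 * pi * (t + real (col v)) / 3) \<in> S}. a < t \<and> t < b"
      if ab: "0 \<le> a" "a < b" "b \<le> 1" for v and a b :: real
    proof -
      obtain p where "cis (2 * pi * p / 3) \<in> S" "a + col v < p" "p < b + col v"
        using generic_circle_set_dense_in_thirds[OF S, of "a + col v" "b + col v"] ab by auto
      then show ?thesis by (intro bexI[of _ "p - col v"]) auto
    qed
  qed (use R in blast)+
  then obtain f where inj: "inj_on f (verts G)"
    and fS: "\<And>v. v \<in> verts G \<Longrightarrow> cis (2 * pi * (f v + real (col v)) / 3) \<in> S"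
    and f01: "\<And>v. v \<in> verts G \<Longrightarrow> 0 < f v \<and> f v < 1"
    and mono: "\<And>u v. u \<in> verts G \<Longrightarrow> v \<in> verts G \<Longrightarrow> R u v \<Longrightarrow> f u < f v"
    by auto
  define p where "p v = f v + real (col v)" for v
  define g where "g v = cis (2 * pi * p v / 3)" for v
  have gS: "g v \<in> S" if "v \<in> verts G" for v using fS[OF that] unfolding g_def p_def .
  have diff: "f u - f v \<noteq> 0" "\<bar>f u - f v\<bar> < 1" if "u \<in> verts G" "v \<in> verts G" "u \<noteq> v" for u v
    using inj f01[OF that(1)] f01[OF that(2)] that unfolding inj_on_def by auto
  have step: "h u v \<longleftrightarrow> (\<forall>k::int. \<bar>p u - p v - 3 * of_int k\<bar> > 1)"
    if uv: "u \<in> verts G" "v \<in> verts G" "u \<noteq> v" "col v = (col u + 1) mod 3" for u v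
  proof -
    have "h u v \<longleftrightarrow> f u - f v < 0"
      using succ[OF uv(1,2,4)] mono[OF uv(1,2)] mono[OF uv(2,1)] by (auto split: if_splits)
    also have "\<dots> \<longleftrightarrow> (\<forall>k::int. \<bar>f u - f v - 1 - 3 * of_int k\<bar> > 1)"
      using far_from_shift_iff[OF diff[OF uv(1-3)]] by blast
    also have "\<dots> \<longleftrightarrow> (\<forall>k::int. \<bar>p u - p v - 3 * of_int k\<bar> > 1)"
    proof -
      have "\<exists>j::int. real (col u) - real (col v) = - 1 + 3 * of_int j"
      proof (cases "col u = 2")
        case True
        then show ?thesis using uv(4) by (intro exI[of _ 1]) simp
      next
        case False
        then have "col v = col u + 1" using uv(4) col[of u] by simp
        then show ?thesis by (intro exI[of _ 0]) simp
      qed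
      then obtain j :: int where "real (col u) - real (col v) = - 1 + 3 * of_int j" by blast
      then have pj: "p u - p v = f u - f v - 1 + 3 * of_int j" unfolding p_def by simp
      have "\<bar>f u - f v - 1 - 3 * of_int k\<bar> = \<bar>p u - p v - 3 * of_int (k + j)\<bar>"
        "\<bar>p u - p v - 3 * of_int k\<bar> = \<bar>f u - f v - 1 - 3 * of_int (k - j)\<bar>" for k :: int
        unfolding pj by (simp_all add: algebra_simps)
      then show ?thesis by metis
    qed
    finally show ?thesis .
  qed
  have neg: "(\<forall>k::int. \<bar>x - y - 3 * of_int k\<bar> > 1) \<longleftrightarrow> (\<forall>k::int. \<bar>y - x - 3 * of_int k\<bar> > 1)" for x y :: real
  proof -
    have "\<bar>x - y - 3 * of_int k\<bar> = \<bar>y - x - 3 * of_int (- k)\<bar>" for k :: int by simp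
    then show ?thesis by (metis minus_minus)
  qed
  have hp: "h u v \<longleftrightarrow> (\<forall>k::int. \<bar>p u - p v - 3 * of_int k\<bar> > 1)"
    if uv: "u \<in> verts G" "v \<in> verts G" for u v
  proof (cases "u = v")
    case True
    then show ?thesis using h_irrefl[of u] by (auto intro!: exI[of _ 0])
  next
    case False
    have "(col u + 1) mod 3 = col v \<or> (col v + 1) mod 3 = col u \<or> col u = col v"
      using col[of u] col[of v] by presburger
    then consider "col v = (col u + 1) mod 3" | "col u = (col v + 1) mod 3" | "col u = col v" by metis
    then show ?thesis
    proof cases
      case 1
      then show ?thesis using step[OF uv False] by blast
    next
      case 2
      then have "h v u \<longleftrightarrow> (\<forall>k::int. \<bar>p v - p u - 3 * of_int k\<bar> > 1)" using step[OF uv(2,1)] False by blast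
      then show ?thesis using neg[of "p u" "p v"] h_sym by blast
    next
      case 3
      then have "\<not> \<bar>p u - p v - 3 * of_int 0\<bar> > 1" using diff[OF uv False] unfolding p_def by simp
      then show ?thesis using same[OF uv 3] by blast
    qed
  qed
  show ?thesis
    unfolding induced_subgraph_iff
  proof (intro exI[of _ g] conjI)
    have V: "verts (graph_complement G) = verts G" unfolding graph_complement_def by simp
    show "g ` verts (graph_complement G) \<subseteq> verts (generic_circular_triangle_free_graph S)"
      unfolding V using gS by (auto simp: generic_circular_triangle_free_graph_def)
    show "inj_on g (verts (graph_complement G))"
      unfolding V
    proof (rule inj_onI, rule ccontr)
      fix u v assume uv: "u \<in> verts G" "v \<in> verts G" "g u = g v" "u \<noteq> v"
      then obtain k :: int where "p u = p v + 3 * of_int k" unfolding g_def cis_third_eq_iff by blast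
      then have j: "f u - f v = of_int (int (col v) - int (col u) + 3 * k)" (is "_ = of_int ?j")
        unfolding p_def by simp
      have "?j = 0" using int_multiple_small[of ?j 1] diff[OF uv(1,2,4)] unfolding j by simp
      then show False using diff[OF uv(1,2,4)] unfolding j by simp
    qed
    show "\<forall>x\<in>verts (graph_complement G). \<forall>y\<in>verts (graph_complement G).
        adj (graph_complement G) x y \<longleftrightarrow> adj (generic_circular_triangle_free_graph S) (g x) (g y)"
      unfolding V h_def[symmetric] using hp gS unfolding g_def generic_adj_iff by blast
  qed
qed

section \<open>Models with distinct end points\<close>

text \<open>Take for each vertex the unit arc that starts at its point, on a circle scaled to circumference 3.
Two such arcs meet iff their starting points are at distance at most 1, and they share an end
point iff the starting points are at distance 0 or 1.  Distance 1 is a third of a turn, which is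
not a rational angle.\<close>

lemma generic_imp_disjoint_end_points:
  fixes G :: "'a graph"
  assumes G: "countable_simple_graph G" and S: "generic_circle_set S"
    and emb: "isomorphic_to_induced_subgraph (graph_complement G) (generic_circular_triangle_free_graph S)"
  shows "\<exists>c r \<A>. circular_arc_model G c r \<A> \<and> unit_arcs c r \<A> \<and>
           2 * pi * r = 3 \<and> (\<forall>A\<in>\<A>. is_closed_arc c r A) \<and>
           (\<forall>A\<in>\<A>. \<forall>B\<in>\<A>. A \<noteq> B \<longrightarrow> arc_end_points c r A \<inter> arc_end_points c r B = {})"
proof -
  define r where "r = 3 / (2 * pi)"
  have r: "r > 0" and circ: "2 * pi * r = 3" unfolding r_def by simp_all
  obtain f where inj: "inj_on f (verts G)" and fS: "f ` verts G \<subseteq> S"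
    and fadj: "\<And>u v. u \<in> verts G \<Longrightarrow> v \<in> verts G \<Longrightarrow>
      adj (graph_complement G) u v \<longleftrightarrow> adj (generic_circular_triangle_free_graph S) (f u) (f v)"
    using emb unfolding induced_subgraph_iff
    by (auto simp: graph_complement_def generic_circular_triangle_free_graph_def)
  have "\<exists>p. f v = cis (2 * pi * p / 3)" if "v \<in> verts G" for v
  proof -
    have "f v \<in> sphere 0 1" using S fS that unfolding generic_circle_set_def by blast
    then have "norm (f v) = 1" by simp
    then show ?thesis by (rule unit_circle_third[where a = 0]) blast
  qed
  then obtain p where p: "\<And>v. v \<in> verts G \<Longrightarrow> f v = cis (2 * pi * p v / 3)" by metis
  define A where "A v = closed_arc 0 r (p v) 1" for v
  have ends: "arc_end_points 0 r (A v) = {circle_point 0 r (p v), circle_point 0 r (p v + 1)}" for v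
    unfolding A_def using arc_end_points_closed_arc[OF r, of 1 0 "p v"] circ by simp
  have pt: "circle_point 0 r s = circle_point 0 r t \<longleftrightarrow> (\<exists>k::int. s = t + 3 * of_int k)" for s t
    using circle_point_eq_iff[OF r, of 0 s t] unfolding circ by (simp add: mult.commute)
  \<comment> \<open>Rational angles never differ by a third of a turn.\<close>
  have apart: "\<not> (\<exists>k::int. p u - p v = of_int e + 3 * of_int k)"
    if uv: "u \<in> verts G" "v \<in> verts G" "u \<noteq> v" and e: "e \<in> {-1, 0, 1}" for u v and e :: int
  proof
    assume "\<exists>k::int. p u - p v = of_int e + 3 * of_int k"
    then obtain k :: int where k: "p u = p v + of_int e + 3 * of_int k" by (auto simp: algebra_simps)
    have ne: "f v \<noteq> f u" using inj uv unfolding inj_on_def by auto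
    then obtain q where q: "q \<in> \<rat>" "f u = f v * cis q"
      using S fS uv unfolding generic_circle_set_def by (metis image_subset_iff)
    define x where "x = 3 * q / (2 * pi)"
    have x: "q = 2 * pi * x / 3" unfolding x_def by simp
    have "f v * cis q = cis (2 * pi * (p v + x) / 3)"
      unfolding p[OF uv(2)] cis_mult x by (simp add: field_simps)
    then have "cis (2 * pi * p u / 3) = cis (2 * pi * (p v + x) / 3)"
      using q(2) p[OF uv(1)] by simp
    then obtain m :: int where m: "p u = p v + x + 3 * of_int m"
      unfolding cis_third_eq_iff by blast
    have "x = of_int (e + 3 * (k - m))" using k m by simp
    moreover have "e + 3 * (k - m) \<noteq> 0"
    proof
      assume "e + 3 * (k - m) = 0"
      moreover have "e = - 1 \<or> e = 0 \<or> e = 1" using e by simp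
      ultimately have "e = 0" "k = m" by presburger+
      then have "f u = f v" unfolding p[OF uv(1)] p[OF uv(2)] cis_third_eq_iff using k by auto
      then show False using ne by simp
    qed
    ultimately obtain n :: int where "x = of_int n" "n \<noteq> 0" by blast
    then have "pi = 3 * q / (2 * of_int n)" using x by (simp add: field_simps)
    then have "pi \<in> \<rat>" using q(1) by (metis Rats_divide Rats_mult Rats_number_of Rats_of_int)
    then show False using pi_irrational by blast
  qed
  have disj: "arc_end_points 0 r (A u) \<inter> arc_end_points 0 r (A v) = {}"
    if uv: "u \<in> verts G" "v \<in> verts G" "u \<noteq> v" for u v
    using apart[OF uv, of 0] apart[OF uv, of 1] apart[OF uv, of "- 1"]
    unfolding ends by (auto simp: pt algebra_simps)
  have Ainj: "inj_on A (verts G)"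
  proof (rule inj_onI, rule ccontr)
    fix u v assume "u \<in> verts G" "v \<in> verts G" "A u = A v" "u \<noteq> v"
    then show False using disj[of u v] ends[of v] by auto
  qed
  have adj: "adj G u v \<longleftrightarrow> A u \<noteq> A v \<and> A u \<inter> A v \<noteq> {}" if uv: "u \<in> verts G" "v \<in> verts G" for u v
  proof -
    have "adj G u v \<longleftrightarrow> u \<noteq> v \<and> \<not> adj (graph_complement G) u v"
      using G uv unfolding graph_complement_def countable_simple_graph_def by auto
    also have "\<dots> \<longleftrightarrow> u \<noteq> v \<and> (\<exists>k::int. \<bar>p u - p v - 3 * of_int k\<bar> \<le> 1)"
      using fS uv unfolding fadj[OF uv] p[OF uv(1)] p[OF uv(2)] generic_adj_iff
      by (auto simp: not_less p[symmetric])
    also have "\<dots> \<longleftrightarrow> u \<noteq> v \<and> A u \<inter> A v \<noteq> {}"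
      unfolding A_def closed_unit_arcs_meet[OF r] circ by (simp add: mult.commute)
    also have "\<dots> \<longleftrightarrow> A u \<noteq> A v \<and> A u \<inter> A v \<noteq> {}"
      using Ainj uv unfolding inj_on_def by auto
    finally show ?thesis .
  qed
  show ?thesis
  proof (intro exI conjI)
    show "2 * pi * r = 3" by (rule circ)
    have "is_closed_arc 0 r (A v)" for v
      unfolding is_closed_arc_def A_def circ by (rule exI[of _ "p v"], rule exI[of _ 1]) simp
    then show closed: "\<forall>B\<in>A ` verts G. is_closed_arc 0 r B" by blast
    show "unit_arcs 0 r (A ` verts G)"
      unfolding unit_arcs_def has_arc_length_def A_def circ by auto
    show "\<forall>B\<in>A ` verts G. \<forall>C\<in>A ` verts G. B \<noteq> C \<longrightarrow>
        arc_end_points 0 r B \<inter> arc_end_points 0 r C = {}"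
      using disj by fast
    have "graph_isomorphic G (intersection_graph (A ` verts G))"
      unfolding graph_isomorphic_def intersection_graph_def bij_betw_def
      using Ainj adj by (intro exI[of _ A]) auto
    then show "circular_arc_model G 0 r (A ` verts G)"
      unfolding circular_arc_model_def using r closed by blast
  qed
qed

text \<open>Lift the starting points of pairwise meeting arcs to the line near a lift \<open>t\<close> of one of them.  As end
points are distinct they lie strictly within distance 1 of \<open>t\<close>, hence within distance less than
2 of each other, and then the arcs can meet only on the line: the detour around the circle, of
circumference 3, is too long.  So all the lifts differ by at most 1 and their supremum is in every
lifted arc. \<close>

lemma disjoint_end_points_imp_Helly:
  assumes model: "circular_arc_model G c r \<A>" "unit_arcs c r \<A>"
    and circ: "2 * pi * r = 3" and closed: "\<forall>A\<in>\<A>. is_closed_arc c r A"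
    and disj: "\<forall>A\<in>\<A>. \<forall>B\<in>\<A>. A \<noteq> B \<longrightarrow> arc_end_points c r A \<inter> arc_end_points c r B = {}"
  shows "Helly \<A>"
  unfolding Helly_def
proof (intro allI impI)
  have r: "r > 0" using model unfolding circular_arc_model_def by blast
  have pos: "\<exists>s. A = closed_arc c r s 1" if "A \<in> \<A>" for A
    using model(2) closed closed_arc_neq_open_arc[OF r] that circ
    unfolding unit_arcs_def has_arc_length_def is_closed_arc_def by metis
  have ends: "arc_end_points c r (closed_arc c r s 1) = {circle_point c r s, circle_point c r (s + 1)}" for s
    using arc_end_points_closed_arc[OF r, of 1] circ by simp
  have pt: "circle_point c r s = circle_point c r t \<longleftrightarrow> (\<exists>k::int. s = t + 3 * of_int k)" for s t
    using circle_point_eq_iff[OF r, of c s t] unfolding circ by (simp add: mult.commute)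
  have shift: "closed_arc c r (s + 3 * of_int k) 1 = closed_arc c r s 1" for s and k :: int
    using unit_arc_shift[OF r, of c True s k] unfolding unit_arc_eq circ by (simp add: mult.commute)
  fix \<B> assume sub: "\<B> \<subseteq> \<A>" and meet: "\<forall>A\<in>\<B>. \<forall>B\<in>\<B>. A \<inter> B \<noteq> {}"
  show "\<Inter> \<B> \<noteq> {}"
  proof (cases "\<B> = {}")
    case False
    then obtain A\<^sub>0 where A0: "A\<^sub>0 \<in> \<B>" by blast
    obtain t where t: "A\<^sub>0 = closed_arc c r t 1" using pos A0 sub by blast
    have "\<exists>s. A = closed_arc c r s 1 \<and> \<bar>s - t\<bar> < 1" if A: "A \<in> \<B>" for A
    proof (cases "A = A\<^sub>0")
      case False
      obtain s where s: "A = closed_arc c r s 1" using pos A sub by blast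
      have "A \<inter> A\<^sub>0 \<noteq> {}" using meet A A0 by blast
      then obtain k :: int where k: "\<bar>s - t - of_int k * 3\<bar> \<le> 1"
        unfolding s t closed_unit_arcs_meet[OF r] circ by blast
      have "arc_end_points c r A \<inter> arc_end_points c r A\<^sub>0 = {}" using disj A A0 sub False by blast
      then have "circle_point c r s \<noteq> circle_point c r (t + 1)" "circle_point c r (s + 1) \<noteq> circle_point c r t"
        unfolding s t ends by auto
      then have "s \<noteq> t + 1 + 3 * of_int k" "s + 1 \<noteq> t + 3 * of_int k"
        unfolding pt by blast+
      then have "\<bar>s + 3 * of_int (- k) - t\<bar> < 1" using k by (auto simp: abs_if split: if_splits)
      then show ?thesis using shift[of s "- k"] s by blast
    qed (use t in auto)
    then obtain s where s: "\<And>A. A \<in> \<B> \<Longrightarrow> A = closed_arc c r (s A) 1" "\<And>A. A \<in> \<B> \<Longrightarrow> \<bar>s A - t\<bar> < 1"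
      by metis
    have near: "s A \<le> s B + 1" if AB: "A \<in> \<B>" "B \<in> \<B>" for A B
    proof -
      have "A \<inter> B \<noteq> {}" using meet AB by blast
      then have "closed_arc c r (s A) 1 \<inter> closed_arc c r (s B) 1 \<noteq> {}"
        using s(1)[OF AB(1)] s(1)[OF AB(2)] by simp
      then obtain k :: int where k: "\<bar>s A - s B - of_int k * 3\<bar> \<le> 1"
        unfolding closed_unit_arcs_meet[OF r] circ by blast
      have "\<bar>of_int k * 3 :: real\<bar> < 3" using k s(2)[OF AB(1)] s(2)[OF AB(2)] by linarith
      then have "k = 0" by (rule int_multiple_small)
      then show ?thesis using k by simp
    qed
    define x where "x = Sup (s ` \<B>)"
    have bdd: "bdd_above (s ` \<B>)" using near[OF _ A0] by (intro bdd_aboveI2)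
    have "circle_point c r x \<in> A" if A: "A \<in> \<B>" for A
    proof -
      have "s A \<le> x" unfolding x_def using A bdd by (intro cSup_upper) auto
      moreover have "x \<le> s A + 1" unfolding x_def using near A False by (intro cSup_least) auto
      ultimately have "circle_point c r x \<in> closed_arc c r (s A) 1" unfolding closed_arc_def by auto
      then show ?thesis using s(1)[OF A] by simp
    qed
    then show ?thesis by blast
  qed simp
qed

text \<open>Three pairwise disjoint closed arcs of length 1 would leave no room for the gaps between them.\<close>

lemma circumference_3_imp_3K1_free:
  assumes model: "circular_arc_model G c r \<A>" "unit_arcs c r \<A>"
    and circ: "2 * pi * r = 3" and closed: "\<forall>A\<in>\<A>. is_closed_arc c r A"
  shows "graph_free {edgeless_graph 3} G"
proof -
  have r: "r > 0" using model unfolding circular_arc_model_def by blast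
  have pos: "\<exists>s. A = closed_arc c r s 1" if "A \<in> \<A>" for A
    using model(2) closed closed_arc_neq_open_arc[OF r] that circ
    unfolding unit_arcs_def has_arc_length_def is_closed_arc_def by metis
  have False if sub: "isomorphic_to_induced_subgraph (edgeless_graph 3) G"
  proof -
    have "graph_isomorphic G (intersection_graph \<A>)"
      using model(1) unfolding circular_arc_model_def by blast
    with sub obtain a :: "nat \<Rightarrow> complex set" where a: "a ` {..<3} \<subseteq> \<A>"
      "\<And>i j. i < 3 \<Longrightarrow> j < 3 \<Longrightarrow> i \<noteq> j \<Longrightarrow> a i \<inter> a j = {}"
      by (rule induced_subgraph_arcs) (simp add: edgeless_graph_def)
    have "a 0 \<in> \<A>" "a 1 \<in> \<A>" "a 2 \<in> \<A>" using a(1) by auto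
    then obtain s t u where s: "a 0 = closed_arc c r s 1" "a 1 = closed_arc c r t 1" "a 2 = closed_arc c r u 1"
      using pos by meson
    have disj: "a 0 \<inter> a 1 = {}" "a 0 \<inter> a 2 = {}" "a 1 \<inter> a 2 = {}" using a(2) by simp_all
    have gap: "\<bar>x - y - of_int k * 3\<bar> > 1" if "closed_arc c r x 1 \<inter> closed_arc c r y 1 = {}" for x y and k :: int
      using that closed_unit_arcs_meet[OF r, of c x y] unfolding circ by (meson not_less)
    have far: "\<bar>s - t - of_int k * 3\<bar> > 1" "\<bar>s - u - of_int k * 3\<bar> > 1" "\<bar>t - u - of_int k * 3\<bar> > 1" for k :: int
      using gap disj unfolding s by blast+
    define k where "k = \<lfloor>(s - t) / 3\<rfloor>"
    define m where "m = \<lfloor>(s - u) / 3\<rfloor>"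
    have "of_int k \<le> (s - t) / 3" "(s - t) / 3 < of_int k + 1"
      "of_int m \<le> (s - u) / 3" "(s - u) / 3 < of_int m + 1" unfolding k_def m_def by linarith+
    moreover have "\<bar>s - t - of_int k * 3\<bar> > 1" "\<bar>s - t - of_int (k + 1) * 3\<bar> > 1"
      "\<bar>s - u - of_int m * 3\<bar> > 1" "\<bar>s - u - of_int (m + 1) * 3\<bar> > 1"
      "\<bar>t - u - of_int (m - k) * 3\<bar> > 1" using far by blast+
    ultimately show False by (simp add: abs_if algebra_simps split: if_splits)
  qed
  then show ?thesis unfolding graph_free_def by blast
qed

section \<open>Helly models of unit arcs\<close>

text \<open>A set of points is not both a closed and an open arc, so the two conditions on the arcs of a model
speak about the same descriptions.\<close>

lemma unit_arc_positions:
  assumes "circular_arc_model G c r \<A>" "unit_arcs c r \<A>"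
  shows "\<exists>cl. \<forall>A\<in>\<A>. \<exists>s. A = unit_arc c r cl s"
proof -
  have r: "r > 0" using assms(1) unfolding circular_arc_model_def by blast
  have len: "1 < 2 * pi * r \<and> (\<exists>s. A = closed_arc c r s 1 \<or> A = open_arc c r s 1)" if "A \<in> \<A>" for A
    using assms(2) that unfolding unit_arcs_def has_arc_length_def by blast
  note ne = closed_arc_neq_open_arc[OF r]
  consider "\<forall>A\<in>\<A>. is_closed_arc c r A" | "\<forall>A\<in>\<A>. is_open_arc c r A"
    using assms(1) unfolding circular_arc_model_def by blast
  then show ?thesis
  proof cases
    case 1
    have "\<exists>s. A = unit_arc c r True s" if "A \<in> \<A>" for A
      using 1 len[OF that] ne[of 1] that unfolding unit_arc_eq is_closed_arc_def by (metis zero_less_one)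
    then show ?thesis by blast
  next
    case 2
    have "\<exists>s. A = unit_arc c r False s" if "A \<in> \<A>" for A
      using 2 len[OF that] ne that unfolding unit_arc_eq is_open_arc_def by metis
    then show ?thesis by blast
  qed
qed

text \<open>Disjoint unit arcs force the circumference to be at least 2, and more than 2 if they are closed.
Then an interval meets at most one of the lifts of an arc.\<close>

lemma hub_lift_unique:
  assumes r: "r > 0" and disj: "unit_arc c r cl s\<^sub>1 \<inter> unit_arc c r cl s\<^sub>2 = {}"
    and m: "unit_interval cl t \<inter> unit_interval cl s \<noteq> {}"
      "unit_interval cl t \<inter> unit_interval cl (s + of_int k * (2 * pi * r)) \<noteq> {}"
  shows "k = 0"
proof -
  define L where "L = 2 * pi * r"
  have "L > 0" using r unfolding L_def by simp
  define j where "j = \<lfloor>(s\<^sub>1 - s\<^sub>2) / L\<rfloor>"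
  have "of_int j \<le> (s\<^sub>1 - s\<^sub>2) / L" "(s\<^sub>1 - s\<^sub>2) / L < of_int j + 1" unfolding j_def by linarith+
  then have d: "0 \<le> s\<^sub>1 - s\<^sub>2 - of_int j * L" "s\<^sub>1 - s\<^sub>2 - of_int j * L < L"
    using \<open>L > 0\<close> by (simp_all add: field_simps)
  have no: "unit_interval cl s\<^sub>1 \<inter> unit_interval cl (s\<^sub>2 + of_int i * L) = {}" for i :: int
    using disj unit_arcs_meet[OF r, of c cl s\<^sub>1 s\<^sub>2] unfolding L_def by blast
  have "\<bar>of_int k * L\<bar> < L"
  proof -
    have "\<not> (if cl then \<bar>s\<^sub>1 - (s\<^sub>2 + of_int i * L)\<bar> \<le> 1 else \<bar>s\<^sub>1 - (s\<^sub>2 + of_int i * L)\<bar> < 1)" for i :: int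
      using no[of i] unit_intervals_meet by blast
    from this[of j] this[of "j + 1"] d
    have "if cl then 2 < L else 2 \<le> L" by (auto simp: algebra_simps split: if_splits)
    moreover have "if cl then \<bar>t - s\<bar> \<le> 1 \<and> \<bar>t - (s + of_int k * L)\<bar> \<le> 1
        else \<bar>t - s\<bar> < 1 \<and> \<bar>t - (s + of_int k * L)\<bar> < 1"
      using m unfolding unit_intervals_meet L_def by simp
    ultimately show ?thesis by (auto split: if_splits)
  qed
  then show ?thesis by (rule int_multiple_small)
qed

text \<open>The hub \<open>H\<close> is cut open to an interval, and every arc of the rim has a unique lift that meets it.
By the Helly property, arcs of the rim that meet do so inside the hub, so their lifts meet too.\<close>

lemma rim_is_unit_interval_graph:
  assumes r: "r > 0" and pos: "\<And>A. A \<in> insert H P \<Longrightarrow> \<exists>s. A = unit_arc c r cl s"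
    and hub: "\<And>A. A \<in> P \<Longrightarrow> H \<inter> A \<noteq> {}"
    and disj: "D \<in> P" "E \<in> P" "D \<inter> E = {}"
    and Helly: "\<And>A B. A \<in> P \<Longrightarrow> B \<in> P \<Longrightarrow> A \<inter> B \<noteq> {} \<Longrightarrow> H \<inter> A \<inter> B \<noteq> {}"
  shows "\<exists>q. \<forall>A\<in>P. \<forall>B\<in>P. A \<inter> B \<noteq> {} \<longleftrightarrow> unit_interval cl (q A) \<inter> unit_interval cl (q B) \<noteq> {}"
proof -
  obtain t where t: "H = unit_arc c r cl t" using pos by blast
  have "\<exists>s. A = unit_arc c r cl s \<and> unit_interval cl t \<inter> unit_interval cl s \<noteq> {}" if A: "A \<in> P" for A
  proof -
    obtain s where s: "A = unit_arc c r cl s" using pos A by blast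
    then obtain k :: int where "unit_interval cl t \<inter> unit_interval cl (s + of_int k * (2 * pi * r)) \<noteq> {}"
      using hub[OF A] unfolding t s unit_arcs_meet[OF r] by blast
    then show ?thesis unfolding s using unit_arc_shift[OF r] by metis
  qed
  then obtain q where q: "\<And>A. A \<in> P \<Longrightarrow> A = unit_arc c r cl (q A)"
    "\<And>A. A \<in> P \<Longrightarrow> unit_interval cl t \<inter> unit_interval cl (q A) \<noteq> {}" by metis
  have disj': "unit_arc c r cl (q D) \<inter> unit_arc c r cl (q E) = {}" using disj q(1) by metis
  have lift: "x \<in> unit_interval cl (q A)"
    if A: "A \<in> P" and x: "x \<in> unit_interval cl t" "circle_point c r x \<in> A" for A x
  proof -
    obtain k :: int where k: "x \<in> unit_interval cl (q A + of_int k * (2 * pi * r))"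
      using x(2) q(1)[OF A] circle_point_mem_unit_arc[OF r] by metis
    then have "k = 0" using hub_lift_unique[OF r disj' q(2)[OF A]] x(1) by blast
    then show ?thesis using k by simp
  qed
  have "A \<inter> B \<noteq> {} \<longleftrightarrow> unit_interval cl (q A) \<inter> unit_interval cl (q B) \<noteq> {}" if AB: "A \<in> P" "B \<in> P" for A B
  proof
    assume "A \<inter> B \<noteq> {}"
    then obtain z where z: "z \<in> H" "z \<in> A" "z \<in> B" using Helly AB by blast
    then obtain x where "x \<in> unit_interval cl t" "z = circle_point c r x" unfolding t unit_arc_def by blast
    then show "unit_interval cl (q A) \<inter> unit_interval cl (q B) \<noteq> {}" using lift AB z by blast
  next
    assume "unit_interval cl (q A) \<inter> unit_interval cl (q B) \<noteq> {}"
    then have "unit_arc c r cl (q A) \<inter> unit_arc c r cl (q B) \<noteq> {}" unfolding unit_arc_def by blast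
    then show "A \<inter> B \<noteq> {}" using q(1) AB by metis
  qed
  then show ?thesis by blast
qed

lemma unit_arc_nonempty: "unit_arc c r cl s \<noteq> {}"
  unfolding unit_arc_def unit_interval_def by (auto simp: not_le)

lemma Helly_pair:
  assumes "Helly \<A>" "A \<in> \<A>" "B \<in> \<A>" "C \<in> \<A>" "A \<noteq> {}" "B \<noteq> {}" "C \<noteq> {}"
    and "A \<inter> B \<noteq> {}" "A \<inter> C \<noteq> {}" "B \<inter> C \<noteq> {}"
  shows "A \<inter> B \<inter> C \<noteq> {}"
proof -
  have "\<Inter> {A, B, C} \<noteq> {}"
    using assms(1) unfolding Helly_def by (rule allE[of _ "{A, B, C}"]) (use assms(2-) in auto)
  then show ?thesis by auto
qed

text \<open>For \<open>n \<ge> 4\<close> the rim contains two non-adjacent vertices; their disjoint arcs make the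
lifts to the hub unique.\<close>

lemma wheel_in_Helly_model:
  assumes model: "circular_arc_model G c r \<A>" "unit_arcs c r \<A>" "Helly \<A>"
    and sub: "isomorphic_to_induced_subgraph (wheel_graph n) G" and n: "n \<ge> 4"
  shows "\<exists>cl q. \<forall>i<n. \<forall>j<n. i \<noteq> j \<longrightarrow>
      (adj (cycle_graph n) i j \<longleftrightarrow> unit_interval cl (q i) \<inter> unit_interval cl (q j) \<noteq> {})"
proof -
  have r: "r > 0" and iso: "graph_isomorphic G (intersection_graph \<A>)"
    using model(1) unfolding circular_arc_model_def by blast+
  obtain cl where cl: "\<And>A. A \<in> \<A> \<Longrightarrow> \<exists>s. A = unit_arc c r cl s"
    using unit_arc_positions[OF model(1,2)] by blast
  have ne: "A \<noteq> {}" if "A \<in> \<A>" for A using cl[OF that] unit_arc_nonempty by metis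
  obtain a :: "nat \<Rightarrow> complex set" where inj: "inj_on a {..n}" and a: "a ` {..n} \<subseteq> \<A>"
    and meet: "\<And>i j. i \<le> n \<Longrightarrow> j \<le> n \<Longrightarrow> i \<noteq> j \<Longrightarrow> adj (wheel_graph n) i j \<longleftrightarrow> a i \<inter> a j \<noteq> {}"
    using sub iso by (rule induced_subgraph_arcs) (simp add: wheel_graph_def)
  have aA: "a i \<in> \<A>" if "i \<le> n" for i using a that by auto
  have hub: "a n \<inter> a i \<noteq> {}" if "i < n" for i
    using meet[of n i] that by (auto simp: wheel_graph_def)
  have rim: "adj (cycle_graph n) i j \<longleftrightarrow> a i \<inter> a j \<noteq> {}" if "i < n" "j < n" "i \<noteq> j" for i j
    using meet[of i j] that by (auto simp: wheel_graph_def)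
  have "a 0 \<inter> a 2 = {}" using rim[of 0 2] n by (auto simp: cycle_graph_def)
  have "\<exists>q. \<forall>A\<in>a ` {..<n}. \<forall>B\<in>a ` {..<n}.
      A \<inter> B \<noteq> {} \<longleftrightarrow> unit_interval cl (q A) \<inter> unit_interval cl (q B) \<noteq> {}"
  proof (rule rim_is_unit_interval_graph[OF r, where H = "a n" and D = "a 0" and E = "a 2"])
    show "a 0 \<inter> a 2 = {}" by fact
    show "\<exists>s. A = unit_arc c r cl s" if "A \<in> insert (a n) (a ` {..<n})" for A
      using that cl aA by (auto intro: less_imp_le)
    show "a n \<inter> A \<noteq> {}" if "A \<in> a ` {..<n}" for A using that hub by auto
    show "a n \<inter> A \<inter> B \<noteq> {}" if AB: "A \<in> a ` {..<n}" "B \<in> a ` {..<n}" "A \<inter> B \<noteq> {}" for A B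
    proof -
      obtain i j where ij: "A = a i" "i < n" "B = a j" "j < n" using AB(1,2) by auto
      then have "A \<in> \<A>" "B \<in> \<A>" "a n \<in> \<A>" using aA by simp_all
      moreover have "a n \<inter> A \<noteq> {}" "a n \<inter> B \<noteq> {}" using hub ij by simp_all
      ultimately show ?thesis using Helly_pair[OF model(3)] ne AB(3) by blast
    qed
  qed (use n in auto)
  then obtain q where "\<forall>A\<in>a ` {..<n}. \<forall>B\<in>a ` {..<n}.
      A \<inter> B \<noteq> {} \<longleftrightarrow> unit_interval cl (q A) \<inter> unit_interval cl (q B) \<noteq> {}" by blast
  then show ?thesis
    using rim by (intro exI[of _ cl] exI[of _ "q \<circ> a"]) auto
qed

lemma C4_not_unit_interval_graph:
  assumes "\<And>i j. i < 4 \<Longrightarrow> j < 4 \<Longrightarrow> i \<noteq> j \<Longrightarrow>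
      adj (cycle_graph 4) i j \<longleftrightarrow> unit_interval cl (q i) \<inter> unit_interval cl (q j) \<noteq> {}"
  shows False
  using assms[of 0 1] assms[of 1 2] assms[of 2 3] assms[of 0 3] assms[of 0 2] assms[of 1 3]
  unfolding unit_intervals_meet
  by (cases cl) (simp_all add: cycle_graph_def abs_if split: if_splits)

lemma C5_not_unit_interval_graph:
  assumes "\<And>i j. i < 5 \<Longrightarrow> j < 5 \<Longrightarrow> i \<noteq> j \<Longrightarrow>
      adj (cycle_graph 5) i j \<longleftrightarrow> unit_interval cl (q i) \<inter> unit_interval cl (q j) \<noteq> {}"
  shows False
  using assms[of 0 1] assms[of 1 2] assms[of 2 3] assms[of 3 4] assms[of 0 4]
    assms[of 0 2] assms[of 0 3] assms[of 1 3] assms[of 1 4] assms[of 2 4]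
  unfolding unit_intervals_meet
  by (cases cl) (simp_all add: cycle_graph_def abs_if split: if_splits)

text \<open>Lift the three arcs to intervals around a common point: the middle interval is covered by the other two.\<close>

lemma unit_arcs_common_point_cover:
  assumes r: "r > 0" and m: "unit_arc c r cl s \<inter> unit_arc c r cl t \<inter> unit_arc c r cl u \<noteq> {}"
  shows "unit_arc c r cl s \<subseteq> unit_arc c r cl t \<union> unit_arc c r cl u \<or>
    unit_arc c r cl t \<subseteq> unit_arc c r cl s \<union> unit_arc c r cl u \<or>
    unit_arc c r cl u \<subseteq> unit_arc c r cl s \<union> unit_arc c r cl t"
proof -
  obtain x where x: "circle_point c r x \<in> unit_arc c r cl s" "circle_point c r x \<in> unit_arc c r cl t"
    "circle_point c r x \<in> unit_arc c r cl u" using m unfolding unit_arc_def by blast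
  have ex: "\<exists>p. x \<in> unit_interval cl p \<and> unit_arc c r cl p = unit_arc c r cl s"
    if "circle_point c r x \<in> unit_arc c r cl s" for s
    using that unit_arc_shift[OF r] unfolding circle_point_mem_unit_arc[OF r] by metis
  obtain s' t' u' where p: "x \<in> unit_interval cl s'" "unit_arc c r cl s' = unit_arc c r cl s"
    "x \<in> unit_interval cl t'" "unit_arc c r cl t' = unit_arc c r cl t"
    "x \<in> unit_interval cl u'" "unit_arc c r cl u' = unit_arc c r cl u"
    using ex x by meson
  have cover: "unit_arc c r cl b \<subseteq> unit_arc c r cl a \<union> unit_arc c r cl d"
    if "x \<in> unit_interval cl a" "x \<in> unit_interval cl b" "x \<in> unit_interval cl d" "a \<le> b" "b \<le> d" for a b d
  proof -
    have "unit_interval cl b \<subseteq> unit_interval cl a \<union> unit_interval cl d"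
      using that unfolding unit_interval_def by (auto split: if_splits)
    then show ?thesis unfolding unit_arc_def by blast
  qed
  consider "s' \<le> t'" "t' \<le> u'" | "u' \<le> t'" "t' \<le> s'" | "t' \<le> s'" "s' \<le> u'" | "u' \<le> s'" "s' \<le> t'"
    | "s' \<le> u'" "u' \<le> t'" | "t' \<le> u'" "u' \<le> s'" by linarith
  then show ?thesis
    using cover[OF p(1,3,5)] cover[OF p(5,3,1)] cover[OF p(3,1,5)] cover[OF p(5,1,3)]
      cover[OF p(1,5,3)] cover[OF p(3,5,1)] unfolding p(2,4,6) by cases blast+
qed

text \<open>The complement of the 6-cycle is a prism.  By the Helly property the three arcs of one of its
triangles have a common point, so one of them is covered by the other two and cannot
meet its partner in the other triangle without one of the others meeting it as well.\<close>

lemma no_complement_C6_in_Helly_model: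
  assumes model: "circular_arc_model G c r \<A>" "unit_arcs c r \<A>" "Helly \<A>"
    and sub: "isomorphic_to_induced_subgraph (graph_complement (cycle_graph 6)) G"
  shows False
proof -
  have r: "r > 0" and iso: "graph_isomorphic G (intersection_graph \<A>)"
    using model(1) unfolding circular_arc_model_def by blast+
  obtain cl where cl: "\<And>A. A \<in> \<A> \<Longrightarrow> \<exists>s. A = unit_arc c r cl s"
    using unit_arc_positions[OF model(1,2)] by blast
  have ne: "A \<noteq> {}" if "A \<in> \<A>" for A using cl[OF that] unit_arc_nonempty by metis
  obtain a :: "nat \<Rightarrow> complex set" where a: "a ` {..<6} \<subseteq> \<A>"
    and meet: "\<And>i j. i < 6 \<Longrightarrow> j < 6 \<Longrightarrow> i \<noteq> j \<Longrightarrow> adj (cycle_graph 6) i j \<longleftrightarrow> a i \<inter> a j = {}"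
    using sub iso by (rule induced_subgraph_arcs) (simp add: graph_complement_def cycle_graph_def, blast)
  have aA: "a i \<in> \<A>" if "i < 6" for i using a that by auto
  have m: "a 0 \<inter> a 2 \<noteq> {}" "a 0 \<inter> a 4 \<noteq> {}" "a 2 \<inter> a 4 \<noteq> {}"
    "a 0 \<inter> a 3 \<noteq> {}" "a 2 \<inter> a 5 \<noteq> {}" "a 4 \<inter> a 1 \<noteq> {}"
    using meet[of 0 2] meet[of 0 4] meet[of 2 4] meet[of 0 3] meet[of 2 5] meet[of 4 1]
    by (simp_all add: cycle_graph_def)
  have d: "a 2 \<inter> a 3 = {}" "a 4 \<inter> a 3 = {}" "a 0 \<inter> a 5 = {}" "a 4 \<inter> a 5 = {}" "a 0 \<inter> a 1 = {}" "a 2 \<inter> a 1 = {}"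
    using meet[of 2 3] meet[of 4 3] meet[of 0 5] meet[of 4 5] meet[of 0 1] meet[of 2 1]
    by (simp_all add: cycle_graph_def)
  have A: "a 0 \<in> \<A>" "a 2 \<in> \<A>" "a 4 \<in> \<A>" by (simp_all add: aA)
  have "a 0 \<inter> a 2 \<inter> a 4 \<noteq> {}"
    by (rule Helly_pair[OF model(3) A ne[OF A(1)] ne[OF A(2)] ne[OF A(3)] m(1-3)])
  moreover obtain s t u where "a 0 = unit_arc c r cl s" "a 2 = unit_arc c r cl t" "a 4 = unit_arc c r cl u"
    using cl A by meson
  ultimately have "a 0 \<subseteq> a 2 \<union> a 4 \<or> a 2 \<subseteq> a 0 \<union> a 4 \<or> a 4 \<subseteq> a 0 \<union> a 2"
    using unit_arcs_common_point_cover[OF r, of c cl s t u] by simp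
  then show False using m(4-6) d by blast
qed

lemma unit_Helly_imp_obstruction_free:
  assumes "graph_free {edgeless_graph 3} G" "unit_Helly_circular_arc_graph G"
  shows "graph_free {edgeless_graph 3, wheel_graph 4, wheel_graph 5, graph_complement (cycle_graph 6)} G"
proof -
  obtain c r \<A> where model: "circular_arc_model G c r \<A>" "unit_arcs c r \<A>" "Helly \<A>"
    using assms(2) unfolding unit_Helly_circular_arc_graph_def by blast
  have "\<not> isomorphic_to_induced_subgraph (wheel_graph 4) G"
  proof
    assume "isomorphic_to_induced_subgraph (wheel_graph 4) G"
    then obtain cl q where "\<forall>i<4. \<forall>j<4. i \<noteq> j \<longrightarrow>
        (adj (cycle_graph 4) i j \<longleftrightarrow> unit_interval cl (q i) \<inter> unit_interval cl (q j) \<noteq> {})"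
      using wheel_in_Helly_model[OF model, of 4] by auto
    then show False by (intro C4_not_unit_interval_graph[of cl q]) blast
  qed
  moreover have "\<not> isomorphic_to_induced_subgraph (wheel_graph 5) G"
  proof
    assume "isomorphic_to_induced_subgraph (wheel_graph 5) G"
    then obtain cl q where "\<forall>i<5. \<forall>j<5. i \<noteq> j \<longrightarrow>
        (adj (cycle_graph 5) i j \<longleftrightarrow> unit_interval cl (q i) \<inter> unit_interval cl (q j) \<noteq> {})"
      using wheel_in_Helly_model[OF model, of 5] by auto
    then show False by (intro C5_not_unit_interval_graph[of cl q]) blast
  qed
  ultimately show ?thesis
    using assms(1) no_complement_C6_in_Helly_model[OF model] unfolding graph_free_def by blast
qed

section \<open>The equivalence\<close>

theorem theorem15:
  fixes G :: "'a graph" and S :: "complex set"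
  assumes "countable_simple_graph G"
    and "generic_circle_set S"
  shows "(graph_free {edgeless_graph 3} G \<and> unit_Helly_circular_arc_graph G
            \<longleftrightarrow> graph_free {edgeless_graph 3, wheel_graph 4, wheel_graph 5,
                            graph_complement (cycle_graph 6)} G)
       \<and> (graph_free {edgeless_graph 3, wheel_graph 4, wheel_graph 5,
                       graph_complement (cycle_graph 6)} G
            \<longleftrightarrow> isomorphic_to_induced_subgraph (graph_complement G)
                  (generic_circular_triangle_free_graph S))
       \<and> (isomorphic_to_induced_subgraph (graph_complement G)
              (generic_circular_triangle_free_graph S)
            \<longleftrightarrow> (\<exists>c r \<A>. circular_arc_model G c r \<A> \<and> unit_arcs c r \<A> \<and>
                   2 * pi * r = 3 \<and> (\<forall>A\<in>\<A>. is_closed_arc c r A) \<and>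
                   (\<forall>A\<in>\<A>. \<forall>B\<in>\<A>. A \<noteq> B \<longrightarrow>
                      arc_end_points c r A \<inter> arc_end_points c r B = {})))"
proof -
  let ?one = "graph_free {edgeless_graph 3} G \<and> unit_Helly_circular_arc_graph G"
  let ?two = "graph_free {edgeless_graph 3, wheel_graph 4, wheel_graph 5,
      graph_complement (cycle_graph 6)} G"
  let ?three = "isomorphic_to_induced_subgraph (graph_complement G)
      (generic_circular_triangle_free_graph S)"
  let ?four = "\<exists>c r \<A>. circular_arc_model G c r \<A> \<and> unit_arcs c r \<A> \<and>
      2 * pi * r = 3 \<and> (\<forall>A\<in>\<A>. is_closed_arc c r A) \<and>
      (\<forall>A\<in>\<A>. \<forall>B\<in>\<A>. A \<noteq> B \<longrightarrow> arc_end_points c r A \<inter> arc_end_points c r B = {})"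
  have "?one \<Longrightarrow> ?two" by (elim conjE) (rule unit_Helly_imp_obstruction_free)
  moreover have "?two \<Longrightarrow> ?three" by (rule obstruction_free_imp_generic[OF assms])
  moreover have "?three \<Longrightarrow> ?four" by (rule generic_imp_disjoint_end_points[OF assms])
  moreover have "?four \<Longrightarrow> ?one"
    unfolding unit_Helly_circular_arc_graph_def
    using disjoint_end_points_imp_Helly circumference_3_imp_3K1_free by meson
  ultimately show ?thesis by argo
qed

end
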